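(* Let a superport network with $p$ superports and $m$ boundary vertices be given, with $m>p$, and let $L$ be its response matrix. Then $$\det L=\frac{\sum_T w(T)}{\sum_F w(F)},$$ where the sum in the denominator is over all valid forests $F$ in the superport network, and the sum in the numerator is over all spanning trees $T$ of the network.
   Context: A superport network with $p\ge 1$ superports is a finite connected graph (without loops or multiple edges) together with non-empty pairwise disjoint sets $A_1,\dots,A_p$ of vertices (superports) and a positive number (conductance) assigned to each edge. Vertices in $M:=A_1\cup\dots\cup A_p$ are called boundary, the others interior; $m:=|M|$. The vertices are numbered $1,\dots,n$ so that $A_1=\{1,\dots,|A_1|\}$, $A_2=\{|A_1|+1,\dots,|A_1|+|A_2|\}$, and so on; thus $M=\{1,\dots,m\}$. Let $c_{kl}=c_{lk}$ be the conductance of the edge $kl$, with $c_{kl}=0$ if there is no such edge (in particular $c_{kk}=0$). The root of a superport is its vertex with the maximal number; $R=\{r_1,\dots,r_p\}$ is the set of roots, $r_k=\sum_{i=1}^k|A_i|$, and $\mathrm{root}(k)$ is the root of the superport containing the boundary vertex $k$. Given real numbers $\Delta U_{k,\mathrm{root}(k)}$ (prescribed voltage differences) for all non-root boundary vertices $k$, the voltages $U_k$ $(1\le k\le n)$ and the currents $I_{kl}$ $(1\le k,l\le n)$ are determined (the $I_{kl}$ uniquely, the $U_k$ uniquely up to a common additive constant) by the following conditions, where $I_k:=\sum_{l=1}^n I_{kl}$: (C) $I_{kl}=c_{kl}(U_k-U_l)$ for all ordered pairs $k,l$; (I) $\sum_{l=1}^n I_{kl}=0$ for each $k>m$; (P)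 $\sum_{k\in A_i}I_k=0$ for each $i=1,\dots,p-1$; (B) $U_k-U_{\mathrm{root}(k)}=\Delta U_{k,\mathrm{root}(k)}$ for each non-root boundary vertex $k$. Let $m>p$ and let $x_1<\dots<x_{m-p}$ be the non-root boundary vertices. The response matrix $L$ is the matrix of the linear map $\mathbb{R}^{m-p}\to\mathbb{R}^{m-p}$, $(\Delta U_{x_1,\mathrm{root}(x_1)},\dots,\Delta U_{x_{m-p},\mathrm{root}(x_{m-p})})\mapsto(I_{x_1},\dots,I_{x_{m-p}})$. A spanning forest is an acyclic subgraph containing all the vertices (isolated vertices allowed). The weight $w(H)$ of a forest $H$ is the product of the conductances of all its edges (an empty product is $1$). Let $\sim$ be the equivalence relation on the vertices for which two boundary vertices are equivalent if and only if they are in the same superport, and the class of each interior vertex is a single vertex. A spanning forest is valid if it becomes a spanning tree in the quotient by $\sim$; the quotient is a multigraph: edges are kept as distinct edges, possibly becoming parallel edges or loops, and a loop or a pair of parallel edges counts as a cycle. *)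

theory Defs
  imports
    "HOL-Library.Disjoint_Sets"
    "Jordan_Normal_Form.Determinant"
begin

section \<open>Undirected multigraphs\<close>

text \<open>
  A multigraph is given by a vertex set \<open>V\<close>, a set \<open>E\<close> of edge names and a map \<open>ends\<close> sending
  an edge to its set of endpoints: two vertices, or one vertex for a loop. A simple graph, whose
  edges are two-element sets of vertices, is the case \<open>ends = (\<lambda>e. e)\<close>.
\<close>

definition adjacency :: "'e set \<Rightarrow> ('e \<Rightarrow> 'v set) \<Rightarrow> 'v rel" where
  "adjacency E ends = {(u, v). \<exists>e\<in>E. ends e = {u, v}}"

definition connected_graph :: "'v set \<Rightarrow> 'e set \<Rightarrow> ('e \<Rightarrow> 'v set) \<Rightarrow> bool" where
  "connected_graph V E ends \<longleftrightarrow> V \<noteq> {} \<and> (\<forall>u\<in>V. \<forall>v\<in>V. (u, v) \<in> (adjacency E ends)\<^sup>*)"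

text \<open>
  Edge \<open>es ! i\<close> joins \<open>vs ! i\<close> to the cyclically next vertex. A loop is a cycle of length 1, and
  two parallel edges form a cycle of length 2; the distinctness of the edges prevents
  a single edge traversed back and forth from counting as a cycle.
\<close>

definition is_cycle :: "'e set \<Rightarrow> ('e \<Rightarrow> 'v set) \<Rightarrow> 'v list \<Rightarrow> 'e list \<Rightarrow> bool" where
  "is_cycle E ends vs es \<longleftrightarrow>
     es \<noteq> [] \<and> length vs = length es \<and> distinct vs \<and> distinct es \<and> set es \<subseteq> E \<and>
     (\<forall>i<length es. ends (es ! i) = {vs ! i, vs ! (Suc i mod length es)})"

definition acyclic_graph :: "'e set \<Rightarrow> ('e \<Rightarrow> 'v set) \<Rightarrow> bool" where
  "acyclic_graph E ends \<longleftrightarrow> \<not> (\<exists>vs es. is_cycle E ends vs es)"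

definition tree_graph :: "'v set \<Rightarrow> 'e set \<Rightarrow> ('e \<Rightarrow> 'v set) \<Rightarrow> bool" where
  "tree_graph V E ends \<longleftrightarrow> connected_graph V E ends \<and> acyclic_graph E ends"


section \<open>Superport networks\<close>

text \<open>
  The vertices are \<open>1, \<dots>, n\<close>, \<open>g\<close> gives the conductance of an edge (its values off \<open>E\<close> are
  irrelevant), and the superports are \<open>A 1, \<dots>, A p\<close>. Assumption \<open>numbering\<close> is the convention that
  the superports occupy consecutive intervals of numbers, in order; it already implies disjointness.
\<close>

locale superport_network =
  fixes n :: nat
    and E :: "nat set set"
    and g :: "nat set \<Rightarrow> real"
    and p :: nat
    and A :: "nat \<Rightarrow> nat set"
  assumes edges: "\<And>e. e \<in> E \<Longrightarrow> e \<subseteq> {1..n} \<and> card e = 2"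
    and connected: "connected_graph {1..n} E (\<lambda>e. e)"
    and conductance_pos: "\<And>e. e \<in> E \<Longrightarrow> g e > 0"
    and p_ge_1: "p \<ge> 1"
    and superport_subset: "\<And>i. i \<in> {1..p} \<Longrightarrow> A i \<subseteq> {1..n}"
    and superport_nonempty: "\<And>i. i \<in> {1..p} \<Longrightarrow> A i \<noteq> {}"
    and superport_disjoint: "disjoint_family_on A {1..p}"
    and numbering: "\<And>i. i \<in> {1..p} \<Longrightarrow> A i = {(\<Sum>j=1..<i. card (A j)) + 1..\<Sum>j=1..i. card (A j)}"
begin

definition boundary :: "nat set" where
  "boundary = (\<Union>i\<in>{1..p}. A i)"

definition m :: nat where
  "m = card boundary"

definition c :: "nat \<Rightarrow> nat \<Rightarrow> real" where
  "c k l = (if {k, l} \<in> E then g {k, l} else 0)"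

definition roots :: "nat set" where
  "roots = (\<lambda>i. Max (A i)) ` {1..p}"

definition root :: "nat \<Rightarrow> nat" where
  "root k = Max (A (THE i. i \<in> {1..p} \<and> k \<in> A i))"

text \<open>The vertices \<open>x\<^sub>1 < \<dots> < x\<^sub>m\<^sub>-\<^sub>p\<close>, indexed from 0: \<open>nonroot j\<close> is \<open>x\<^sub>j\<^sub>+\<^sub>1\<close>.\<close>

definition nonroot :: "nat \<Rightarrow> nat" where
  "nonroot j = sorted_list_of_set (boundary - roots) ! j"

definition net_current :: "(nat \<Rightarrow> nat \<Rightarrow> real) \<Rightarrow> nat \<Rightarrow> real" where
  "net_current I k = (\<Sum>l=1..n. I k l)"

text \<open>Conditions (C), (I), (P), (B), in this order; \<open>dU k\<close> is the prescribed \<open>U k - U (root k)\<close>.\<close>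

definition is_solution ::
  "(nat \<Rightarrow> real) \<Rightarrow> (nat \<Rightarrow> real) \<Rightarrow> (nat \<Rightarrow> nat \<Rightarrow> real) \<Rightarrow> bool" where
  "is_solution dU U I \<longleftrightarrow>
     (\<forall>k\<in>{1..n}. \<forall>l\<in>{1..n}. I k l = c k l * (U k - U l)) \<and>
     (\<forall>k\<in>{1..n}. k > m \<longrightarrow> (\<Sum>l=1..n. I k l) = 0) \<and>
     (\<forall>i\<in>{1..<p}. (\<Sum>k\<in>A i. net_current I k) = 0) \<and>
     (\<forall>k\<in>boundary - roots. U k - U (root k) = dU k)"

definition response :: "real vec \<Rightarrow> real vec" where
  "response d = (THE y. \<exists>dU U I. is_solution dU U I \<and>
     d = vec (m - p) (\<lambda>j. dU (nonroot j)) \<and>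
     y = vec (m - p) (\<lambda>j. net_current I (nonroot j)))"

text \<open>Column \<open>j\<close> is the image of the \<open>j\<close>-th standard basis vector.\<close>

definition response_matrix :: "real mat" where
  "response_matrix = mat (m - p) (m - p) (\<lambda>(i, j). response (unit_vec (m - p) j) $ i)"

definition weight :: "nat set set \<Rightarrow> real" where
  "weight H = (\<Prod>e\<in>H. g e)"

text \<open>
  A subgraph containing all the vertices is identified with its edge set.
\<close>

definition spanning_trees :: "nat set set set" where
  "spanning_trees = {T. T \<subseteq> E \<and> tree_graph {1..n} T (\<lambda>e. e)}"

definition spanning_forests :: "nat set set set" where
  "spanning_forests = {F. F \<subseteq> E \<and> acyclic_graph F (\<lambda>e. e)}"

definition superport_rel :: "nat rel" where
  "superport_rel = {(k, l). k \<in> {1..n} \<and> l \<in> {1..n} \<and>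
     (k = l \<or> (\<exists>i\<in>{1..p}. k \<in> A i \<and> l \<in> A i))}"

text \<open>
  In the quotient multigraph the edges keep their names, and only their endpoints are replaced by
  equivalence classes.
\<close>

definition quotient_ends :: "nat set \<Rightarrow> nat set set" where
  "quotient_ends e = (\<lambda>v. superport_rel `` {v}) ` e"

definition valid_forests :: "nat set set set" where
  "valid_forests =
     {F \<in> spanning_forests. tree_graph ({1..n} // superport_rel) F quotient_ends}"

end

end

theory Submission
  imports Defs
begin

text \<open>
  Ground the root of the last superport. In the coordinates consisting of the prescribed voltage
  differences, followed by the voltages of the remaining roots and of the interior vertices, and
  the dual coordinates for currents, the reduced Laplacian becomes a block matrix
  \<open>[[AA, BB], [CC, DD]]\<close> with the same determinant, as the change of coordinates is unitriangular.
  Conditions (I) and (P) say that the second block of currents vanishes, so the response matrix is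
  the Schur complement of \<open>DD\<close>, and \<open>DD\<close> itself is the reduced Laplacian of the quotient
  multigraph. Two applications of the matrix-tree theorem give the quotient of sums.

  The matrix-tree theorem is derived from the Cauchy-Binet expansion of the Laplacian over edge sets
  \<open>F\<close> of the right size. The square of the minor at \<open>F\<close> is 1 if \<open>F\<close> is connected, because paths
  provide an integral inverse, and 0 otherwise, because the indicator of the vertices not connected
  to the ground is a kernel vector.
\<close>

section \<open>Cauchy-Binet expansion of a weighted Gram determinant\<close>

text \<open>Any two bijections onto \<open>F\<close> differ by a permutation of the index set. The
  \<open>restrict\<close> reconciles extensional functions with permutations, which are the identity
  outside \<open>{0..<N}\<close>.\<close>

lemma sum_permutes_enum:
  fixes h :: "(nat \<Rightarrow> 'e) \<Rightarrow> 'a :: comm_monoid_add"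
  assumes en: "bij_betw en {0..<N} F"
  shows "(\<Sum>f\<in>{f \<in> {0..<N} \<rightarrow>\<^sub>E F. bij_betw f {0..<N} F}. h f) =
    (\<Sum>\<pi> | \<pi> permutes {0..<N}. h (restrict (en \<circ> \<pi>) {0..<N}))"
proof (rule sym, rule sum.reindex_bij_witness[where
      j = "\<lambda>\<pi>. restrict (en \<circ> \<pi>) {0..<N}" and
      i = "\<lambda>f x. if x \<in> {0..<N} then inv_into {0..<N} en (f x) else x"], goal_cases)
  case (1 \<pi>)
  then have p: "\<pi> permutes {0..<N}" by simp
  show ?case
  proof
    fix x
    show "(if x \<in> {0..<N} then inv_into {0..<N} en (restrict (en \<circ> \<pi>) {0..<N} x) else x) = \<pi> x"
      using permutes_in_image[OF p, of x] permutes_not_in[OF p, of x] en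
      by (auto simp: bij_betw_def)
  qed
next
  case (2 \<pi>)
  then have p: "\<pi> permutes {0..<N}" by simp
  have "bij_betw (en \<circ> \<pi>) {0..<N} F"
    using bij_betw_trans[OF permutes_imp_bij[OF p] en] .
  then have "bij_betw (restrict (en \<circ> \<pi>) {0..<N}) {0..<N} F"
    using bij_betw_cong[of "{0..<N}" "restrict (en \<circ> \<pi>) {0..<N}" "en \<circ> \<pi>" F] by auto
  then show ?case by (auto simp: bij_betw_def)
next
  case (3 f)
  then have f: "f \<in> {0..<N} \<rightarrow>\<^sub>E F" "bij_betw f {0..<N} F" by auto
  show ?case
  proof
    fix x
    show "restrict (en \<circ> (\<lambda>x. if x \<in> {0..<N} then inv_into {0..<N} en (f x) else x)) {0..<N} x = f x"
    proof (cases "x \<in> {0..<N}")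
      case True
      then have "f x \<in> en ` {0..<N}" using f en by (auto simp: bij_betw_def)
      then show ?thesis using True by (simp add: f_inv_into_f)
    next
      case False
      then show ?thesis using f(1) by (auto simp: PiE_def extensional_def)
    qed
  qed
next
  case (4 f)
  then have f: "bij_betw f {0..<N} F" by auto
  have "bij_betw (inv_into {0..<N} en \<circ> f) {0..<N} {0..<N}"
    by (rule bij_betw_trans[OF f bij_betw_inv_into[OF en]])
  then have "bij_betw (\<lambda>x. if x \<in> {0..<N} then inv_into {0..<N} en (f x) else x) {0..<N} {0..<N}"
    by (rule bij_betw_cong[THEN iffD1, rotated]) auto
  then show ?case by (auto intro!: bij_imp_permutes)
next
  case (5 \<pi>)
  then show ?case by simp
qed

lemma permutes_lt: "\<pi> permutes {0..<N} \<Longrightarrow> i < N \<Longrightarrow> \<pi> i < (N :: nat)"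
  using permutes_in_image[of \<pi> "{0..<N}" i] by simp

text \<open>Multilinear expansion picks one edge \<open>f i\<close> for each row \<open>i\<close>.
  Picks with a repetition die because two rows agree; the others are grouped by their image
  \<open>F\<close>. The enumeration \<open>en F\<close> is arbitrary, since the square absorbs its
  sign.\<close>

lemma det_gram:
  fixes w :: "'e \<Rightarrow> 'a :: comm_ring_1" and b :: "'e \<Rightarrow> nat \<Rightarrow> 'a"
  assumes E: "finite E"
    and en: "\<And>F. F \<subseteq> E \<Longrightarrow> card F = N \<Longrightarrow> bij_betw (en F) {0..<N} F"
  shows "det (mat N N (\<lambda>(i, j). \<Sum>e\<in>E. w e * b e i * b e j)) =
    (\<Sum>F | F \<subseteq> E \<and> card F = N. (\<Prod>e\<in>F. w e) * (det (mat N N (\<lambda>(i, j). b (en F i) j)))\<^sup>2)"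
proof -
  let ?N = "{0..<N}"
  let ?P = "{\<pi>. \<pi> permutes ?N}"
  let ?G = "?N \<rightarrow>\<^sub>E E"
  define D where "D f = det (mat N N (\<lambda>(i, j). b (f i) j))" for f :: "nat \<Rightarrow> 'e"
  \<comment> \<open>The contribution of the picks \<open>f\<close>: the factors
    \<open>w (f i) * b (f i) i\<close> pulled out of the rows, times the determinant of what
    remains.\<close>
  define t where "t f = (\<Prod>i\<in>?N. w (f i)) * (\<Prod>i\<in>?N. b (f i) i) * D f" for f
  have finP: "finite ?P" by (rule finite_permutations) simp
  have finG: "finite ?G" by (intro finite_PiE) (auto simp: E)
  have D_def': "D f = (\<Sum>\<pi>\<in>?P. signof \<pi> * (\<Prod>i\<in>?N. b (f i) (\<pi> i)))" for f
    unfolding D_def det_def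
    by (auto intro!: sum.cong prod.cong arg_cong2[where f = "(*)"] dest: permutes_lt)
  have D_cong: "D f = D f'" if "\<And>i. i \<in> ?N \<Longrightarrow> f i = f' i" for f f'
    unfolding D_def using that by (intro arg_cong[where f = det] eq_matI) auto
  have t_cong: "t f = t f'" if "\<And>i. i \<in> ?N \<Longrightarrow> f i = f' i" for f f'
    unfolding t_def using that D_cong[of f f'] by (auto intro!: arg_cong2[where f = "(*)"] prod.cong)
  have "det (mat N N (\<lambda>(i, j). \<Sum>e\<in>E. w e * b e i * b e j)) =
    (\<Sum>\<pi>\<in>?P. signof \<pi> * (\<Prod>i\<in>?N. \<Sum>e\<in>E. w e * b e i * b e (\<pi> i)))"
    unfolding det_def
    by (auto intro!: sum.cong prod.cong arg_cong2[where f = "(*)"] dest: permutes_lt)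
  also have "\<dots> = (\<Sum>\<pi>\<in>?P. \<Sum>f\<in>?G. signof \<pi> * (\<Prod>i\<in>?N. w (f i) * b (f i) i * b (f i) (\<pi> i)))"
    by (intro sum.cong refl, subst prod_sum_PiE) (auto simp: E sum_distrib_left)
  also have "\<dots> = (\<Sum>f\<in>?G. \<Sum>\<pi>\<in>?P. signof \<pi> * (\<Prod>i\<in>?N. w (f i) * b (f i) i * b (f i) (\<pi> i)))"
    by (rule sum.swap)
  also have "\<dots> = (\<Sum>f\<in>?G. t f)"
    unfolding t_def D_def' sum_distrib_left by (simp add: prod.distrib algebra_simps)
  also have "\<dots> = (\<Sum>f\<in>{f \<in> ?G. inj_on f ?N}. t f)"
  proof (rule sum.mono_neutral_right[OF finG])
    show "\<forall>f\<in>?G - {f \<in> ?G. inj_on f ?N}. t f = 0"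
    proof
      fix f assume "f \<in> ?G - {f \<in> ?G. inj_on f ?N}"
      then obtain i j where ij: "i \<noteq> j" "i < N" "j < N" "f i = f j"
        by (auto simp: inj_on_def)
      have "D f = 0" unfolding D_def
        by (rule det_identical_rows[OF _ ij(1-3)]) (use ij in \<open>auto intro!: eq_vecI\<close>)
      then show "t f = 0" by (simp add: t_def)
    qed
  qed auto
  also have "\<dots> = (\<Sum>F | F \<subseteq> E \<and> card F = N. \<Sum>f\<in>{f \<in> {f \<in> ?G. inj_on f ?N}. f ` ?N = F}. t f)"
    by (rule sum.group[symmetric]) (use finG E in \<open>auto simp: card_image\<close>)
  also have "\<dots> = (\<Sum>F | F \<subseteq> E \<and> card F = N. (\<Prod>e\<in>F. w e) * (D (en F))\<^sup>2)"
  proof (rule sum.cong[OF refl])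
    fix F assume "F \<in> {F. F \<subseteq> E \<and> card F = N}"
    then have F: "F \<subseteq> E" "card F = N" by auto
    note enF = en[OF F]
    let ?B = "mat N N (\<lambda>(i, j). b (en F i) j)"
    have B: "?B \<in> carrier_mat N N" by simp
    have "{f \<in> {f \<in> ?G. inj_on f ?N}. f ` ?N = F} = {f \<in> ?N \<rightarrow>\<^sub>E F. bij_betw f ?N F}"
      using F by (auto simp: bij_betw_def)
    then have "(\<Sum>f\<in>{f \<in> {f \<in> ?G. inj_on f ?N}. f ` ?N = F}. t f) =
        (\<Sum>\<pi>\<in>?P. t (restrict (en F \<circ> \<pi>) ?N))"
      using sum_permutes_enum[OF enF, of t] by simp
    also have "\<dots> = (\<Sum>\<pi>\<in>?P. t (en F \<circ> \<pi>))"
      by (intro sum.cong refl t_cong) auto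
    \<comment> \<open>Reordering the picks by \<pi> permutes the rows of the minor, which produces
      the sign. Together with the leftover products this sign sums over \<pi> to the same minor
      again, transposed; hence the square.\<close>
    also have "\<dots> = (\<Sum>\<pi>\<in>?P. (\<Prod>e\<in>F. w e) * D (en F) * (signof \<pi> * (\<Prod>i\<in>?N. b (en F (\<pi> i)) i)))"
    proof (rule sum.cong[OF refl])
      fix \<pi> assume "\<pi> \<in> ?P"
      then have p: "\<pi> permutes ?N" by simp
      have lt: "\<pi> i < N" if "i < N" for i using permutes_in_image[OF p, of i] that by auto
      have "(\<Prod>i\<in>?N. w ((en F \<circ> \<pi>) i)) = (\<Prod>e\<in>F. w e)"
        by (rule prod.reindex_bij_betw[OF bij_betw_trans[OF permutes_imp_bij[OF p] enF]])
      moreover have "D (en F \<circ> \<pi>) = signof \<pi> * D (en F)"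
      proof -
        have "D (en F \<circ> \<pi>) = det (mat N N (\<lambda>(i, j). ?B $$ (\<pi> i, j)))"
          unfolding D_def by (intro arg_cong[where f = det] eq_matI) (auto simp: lt)
        also have "\<dots> = signof \<pi> * det ?B" by (rule det_permute_rows[OF B p])
        finally show ?thesis by (simp add: D_def)
      qed
      ultimately show "t (en F \<circ> \<pi>) =
        (\<Prod>e\<in>F. w e) * D (en F) * (signof \<pi> * (\<Prod>i\<in>?N. b (en F (\<pi> i)) i))"
        unfolding t_def by (simp add: algebra_simps)
    qed
    also have "\<dots> = (\<Prod>e\<in>F. w e) * D (en F) * (\<Sum>\<pi>\<in>?P. signof \<pi> * (\<Prod>i\<in>?N. b (en F (\<pi> i)) i))"
      by (simp add: sum_distrib_left)
    also have "(\<Sum>\<pi>\<in>?P. signof \<pi> * (\<Prod>i\<in>?N. b (en F (\<pi> i)) i)) = det (transpose_mat ?B)"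
      unfolding det_def
      by (auto intro!: sum.cong prod.cong arg_cong2[where f = "(*)"] dest: permutes_lt)
    also have "\<dots> = det ?B" by (rule det_transpose[OF B])
    finally show "(\<Sum>f\<in>{f \<in> {f \<in> ?G. inj_on f ?N}. f ` ?N = F}. t f) =
        (\<Prod>e\<in>F. w e) * (D (en F))\<^sup>2"
      by (simp add: D_def power2_eq_square algebra_simps)
  qed
  finally show ?thesis unfolding D_def .
qed

section \<open>Connectivity and acyclicity of multigraphs\<close>

lemma sym_adjacency: "sym (adjacency F ends)"
  by (auto simp: sym_def adjacency_def insert_commute)

lemma equiv_reach: "equiv UNIV ((adjacency F ends)\<^sup>*)"
  by (intro equivI refl_rtrancl sym_rtrancl sym_adjacency trans_rtrancl) auto

lemma reach_sym: "(u, v) \<in> (adjacency F ends)\<^sup>* \<Longrightarrow> (v, u) \<in> (adjacency F ends)\<^sup>*"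
  by (meson sym_adjacency sym_rtrancl symD)

lemma reach_mono: "F \<subseteq> G \<Longrightarrow> (adjacency F ends)\<^sup>* \<subseteq> (adjacency G ends)\<^sup>*"
  by (intro rtrancl_mono) (auto simp: adjacency_def)

text \<open>Induction along the walk: if the new endpoint was visited before, the path is cut back
  to that visit.\<close>

lemma simple_path_exists:
  assumes "(u, v) \<in> R\<^sup>*"
  shows "\<exists>vs. vs \<noteq> [] \<and> hd vs = u \<and> last vs = v \<and> distinct vs \<and>
    (\<forall>i. Suc i < length vs \<longrightarrow> (vs ! i, vs ! Suc i) \<in> R)"
  using assms
proof (induction rule: rtrancl_induct)
  case base
  show ?case by (rule exI[of _ "[u]"]) auto
next
  case (step x y)
  then obtain vs where vs: "vs \<noteq> []" "hd vs = u" "last vs = x" "distinct vs"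
    "\<And>i. Suc i < length vs \<Longrightarrow> (vs ! i, vs ! Suc i) \<in> R" by blast
  show ?case
  proof (cases "y \<in> set vs")
    case False
    have "((vs @ [y]) ! i, (vs @ [y]) ! Suc i) \<in> R" if "Suc i < length (vs @ [y])" for i
    proof (cases "Suc i < length vs")
      case True
      then show ?thesis using vs(5) by (simp add: nth_append)
    next
      case False
      with that have "i = length vs - 1" "Suc i = length vs" by auto
      then show ?thesis using step.hyps vs(1,3) by (simp add: nth_append last_conv_nth)
    qed
    then show ?thesis using vs False by (intro exI[of _ "vs @ [y]"]) auto
  next
    case True
    then obtain k where k: "k < length vs" "vs ! k = y" by (auto simp: in_set_conv_nth)
    let ?ws = "take (Suc k) vs"
    have "last ?ws = y" using k by (simp add: take_Suc_conv_app_nth)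
    moreover have "hd ?ws = u" "?ws \<noteq> []" "distinct ?ws" using vs by (auto simp: hd_take)
    ultimately show ?thesis using vs(5) by (intro exI[of _ ?ws]) auto
  qed
qed

text \<open>A simple path avoiding \<open>e\<close> between its ends closes up with \<open>e\<close>
  to a cycle, and a cycle without its last edge is such a path. Loops are covered as well:
  reachability is reflexive, so a loop is never a bridge.\<close>

lemma acyclic_graph_iff_bridges:
  "acyclic_graph F ends \<longleftrightarrow>
    (\<forall>e\<in>F. \<forall>u v. ends e = {u, v} \<longrightarrow> (u, v) \<notin> (adjacency (F - {e}) ends)\<^sup>*)"
    (is "_ \<longleftrightarrow> ?bridges")
proof
  assume ac: "acyclic_graph F ends"
  show ?bridges
  proof (intro ballI allI impI notI)
    fix e u v
    assume e: "e \<in> F" "ends e = {u, v}" and r: "(u, v) \<in> (adjacency (F - {e}) ends)\<^sup>*"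
    from simple_path_exists[OF r] obtain vs where
      vs: "vs \<noteq> []" "hd vs = u" "last vs = v" "distinct vs"
      "\<And>i. Suc i < length vs \<Longrightarrow> (vs ! i, vs ! Suc i) \<in> adjacency (F - {e}) ends" by blast
    define k where "k = length vs - 1"
    have len: "length vs = Suc k" using vs(1) by (simp add: k_def)
    have "\<exists>f. \<forall>i<k. f i \<in> F - {e} \<and> ends (f i) = {vs ! i, vs ! Suc i}"
      using vs(5) len unfolding adjacency_def by (intro choice) (auto simp: Bex_def)
    then obtain f where f: "\<And>i. i < k \<Longrightarrow> f i \<in> F - {e}"
      "\<And>i. i < k \<Longrightarrow> ends (f i) = {vs ! i, vs ! Suc i}" by blast
    define es where "es = map f [0..<k] @ [e]"
    have eq: "vs ! i = vs ! j \<longleftrightarrow> i = j" if "i \<le> k" "j \<le> k" for i j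
      using vs(4) that by (auto simp: nth_eq_iff_index_eq len)
    \<comment> \<open>The edges \<open>f i\<close> are merely chosen. They are distinct because an
      edge used at two positions would force the simple path to repeat a vertex.\<close>
    have "inj_on f {0..<k}"
    proof (rule inj_onI)
      fix i j assume ij: "i \<in> {0..<k}" "j \<in> {0..<k}" "f i = f j"
      then have "{vs ! i, vs ! Suc i} = {vs ! j, vs ! Suc j}" using f(2)[of i] f(2)[of j] by auto
      then show "i = j" using ij by (auto simp: doubleton_eq_iff eq)
    qed
    then have "distinct es" using f(1) by (force simp: es_def distinct_map)
    moreover have "set es \<subseteq> F" using f(1) e by (auto simp: es_def)
    \<comment> \<open>At the last index \<open>k\<close> the successor wraps around to 0, and there
      \<open>e\<close> joins the last vertex \<open>v\<close> back to the first vertex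
      \<open>u\<close>.\<close>
    moreover have "ends (es ! i) = {vs ! i, vs ! (Suc i mod length es)}" if "i < length es" for i
    proof (cases "i < k")
      case True
      then show ?thesis using f(2) by (simp add: es_def nth_append)
    next
      case False
      with that have "i = k" by (simp add: es_def)
      then show ?thesis using e(2) vs(1-3) len
        by (auto simp: es_def nth_append hd_conv_nth last_conv_nth)
    qed
    ultimately have "is_cycle F ends vs es"
      unfolding is_cycle_def using vs(4) len by (auto simp: es_def)
    with ac show False by (auto simp: acyclic_graph_def)
  qed
next
  assume br: ?bridges
  show "acyclic_graph F ends"
    unfolding acyclic_graph_def
  proof (rule notI, elim exE)
    fix vs es assume "is_cycle F ends vs es"
    then have c: "es \<noteq> []" "distinct es" "set es \<subseteq> F"
      "\<And>i. i < length es \<Longrightarrow> ends (es ! i) = {vs ! i, vs ! (Suc i mod length es)}"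
      by (auto simp: is_cycle_def)
    define k where "k = length es - 1"
    have len: "length es = Suc k" using c(1) by (simp add: k_def)
    let ?e = "es ! k"
    \<comment> \<open>Going around the cycle from vertex 0 to vertex \<open>k\<close> uses the edges
      before \<open>?e\<close> only, and these differ from \<open>?e\<close> by
      distinctness.\<close>
    have "(vs ! 0, vs ! i) \<in> (adjacency (F - {?e}) ends)\<^sup>*" if "i \<le> k" for i
      using that
    proof (induction i)
      case (Suc i)
      have "es ! i \<in> F - {?e}"
        using Suc.prems c(2,3) len by (auto simp: nth_eq_iff_index_eq)
      moreover have "ends (es ! i) = {vs ! i, vs ! Suc i}"
        using c(4)[of i] Suc.prems len by simp
      ultimately have "(vs ! i, vs ! Suc i) \<in> adjacency (F - {?e}) ends"
        by (auto simp: adjacency_def)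
      with Suc show ?case by (simp add: rtrancl.rtrancl_into_rtrancl)
    qed simp
    moreover have "?e \<in> F" "ends ?e = {vs ! 0, vs ! k}"
      using c(3) c(4)[of k] len by (auto simp: insert_commute)
    ultimately show False using br by blast
  qed
qed

text \<open>A new edge merges the classes of its two ends and leaves all other classes alone. If the
  ends were already connected, the merged class is the old one.\<close>

lemma reach_insert:
  assumes "ends e = {a, b}"
  shows "(adjacency (insert e F) ends)\<^sup>* `` {x} =
    (let R = (adjacency F ends)\<^sup>* in
      if x \<in> R `` {a} \<union> R `` {b} then R `` {a} \<union> R `` {b} else R `` {x})"
proof -
  define R where "R = (adjacency F ends)\<^sup>*"
  define R' where "R' = (adjacency (insert e F) ends)\<^sup>*"
  have adj: "adjacency (insert e F) ends = adjacency F ends \<union> {(a, b), (b, a)}"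
    using assms by (auto simp: adjacency_def doubleton_eq_iff)
  have sub: "R \<subseteq> R'" unfolding R_def R'_def by (rule reach_mono) auto
  have ab: "(a, b) \<in> R'" "(b, a) \<in> R'" unfolding R'_def adj by auto
  have symR: "(x, y) \<in> R \<Longrightarrow> (y, x) \<in> R" for x y unfolding R_def by (rule reach_sym)
  have symR': "(x, y) \<in> R' \<Longrightarrow> (y, x) \<in> R'" for x y unfolding R'_def by (rule reach_sym)
  have trR: "(x, y) \<in> R \<Longrightarrow> (y, z) \<in> R \<Longrightarrow> (x, z) \<in> R" for x y z
    unfolding R_def by (rule rtrancl_trans)
  have trR': "(x, y) \<in> R' \<Longrightarrow> (y, z) \<in> R' \<Longrightarrow> (x, z) \<in> R'" for x y z
    unfolding R'_def by (rule rtrancl_trans)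
  have rfl: "(x, x) \<in> R" for x unfolding R_def by simp
  \<comment> \<open>A walk in the larger graph either never needs the new edge, or starts and ends
    in the classes of \<open>a\<close> and \<open>b\<close>; this alternative survives each further
    step.\<close>
  have fwd: "(x, y) \<in> R \<or> x \<in> R `` {a, b} \<and> y \<in> R `` {a, b}" if "(x, y) \<in> R'" for y
    using that unfolding R'_def
  proof (induction rule: rtrancl_induct)
    case base
    then show ?case by (simp add: rfl)
  next
    case (step y z)
    from step.hyps(2) consider "(y, z) \<in> R" | "(y, z) = (a, b)" | "(y, z) = (b, a)"
      unfolding adj R_def by blast
    then show ?case using step.IH trR symR rfl by cases (blast+)
  qed
  have "R' `` {x} = (if x \<in> R `` {a} \<union> R `` {b} then R `` {a} \<union> R `` {b} else R `` {x})"
  proof (cases "x \<in> R `` {a} \<union> R `` {b}")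
    case True
    then have "y \<in> R `` {a} \<union> R `` {b}" if "(x, y) \<in> R'" for y
      using fwd[OF that] trR by blast
    moreover have "(x, y) \<in> R'" if "y \<in> R `` {a} \<union> R `` {b}" for y
    proof -
      have "(a, x) \<in> R'" "(a, y) \<in> R'" using that True sub ab trR' by blast+
      then show ?thesis using trR' symR' by blast
    qed
    ultimately show ?thesis using True by auto
  next
    case False
    then show ?thesis using fwd sub by auto
  qed
  then show ?thesis by (simp add: R_def R'_def Let_def)
qed

section \<open>Counting components, and trees by their number of edges\<close>

definition components :: "'v set \<Rightarrow> 'e set \<Rightarrow> ('e \<Rightarrow> 'v set) \<Rightarrow> 'v set set" where
  "components V F ends = (\<lambda>v. (adjacency F ends)\<^sup>* `` {v}) ` V"

lemma card_components_insert:
  assumes V: "finite V" and e: "ends e = {a, b}" "a \<in> V" "b \<in> V"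
  shows "card (components V (insert e F) ends) =
    (if (a, b) \<in> (adjacency F ends)\<^sup>* then card (components V F ends)
     else card (components V F ends) - 1)"
proof -
  define R where "R = (adjacency F ends)\<^sup>*"
  define C where "C v = R `` {v}" for v
  have eqv: "equiv UNIV R" unfolding R_def by (rule equiv_reach)
  have C_eq: "C x = C y \<longleftrightarrow> (x, y) \<in> R" for x y
    unfolding C_def using eq_equiv_class_iff[OF eqv] by auto
  have C_mem: "y \<in> C x \<longleftrightarrow> C x = C y" for x y
    using C_eq[of x y] by (auto simp: C_def)
  have comp: "components V F ends = C ` V"
    by (simp add: components_def C_def R_def)
  \<comment> \<open>The map from old components to new ones; \<open>C a\<close> and
    \<open>C b\<close> are the only two that it can identify.\<close>
  define \<phi> where "\<phi> X = (if X = C a \<or> X = C b then C a \<union> C b else X)" for X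
  have "(adjacency (insert e F) ends)\<^sup>* `` {x} = \<phi> (C x)" for x
  proof -
    have "x \<in> C a \<longleftrightarrow> C x = C a" "x \<in> C b \<longleftrightarrow> C x = C b"
      using C_mem[of x a] C_mem[of x b] by metis+
    then show ?thesis
      by (simp only: reach_insert[where ends = ends, OF e(1)] \<phi>_def Let_def Un_iff
          flip: C_def R_def)
  qed
  then have comp': "components V (insert e F) ends = \<phi> ` C ` V"
    by (simp add: components_def image_image)
  show ?thesis
  proof (cases "(a, b) \<in> R")
    case True
    then have "\<phi> X = X" for X using C_eq[of a b] by (auto simp: \<phi>_def)
    then show ?thesis using True by (simp add: comp comp' R_def)
  next
    case False
    then have ne: "C a \<noteq> C b" using C_eq by simp
    have "\<phi> ` C ` V = \<phi> ` (C ` V - {C a})"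
    proof -
      have "\<phi> (C a) = \<phi> (C b)" by (simp add: \<phi>_def)
      moreover have "C b \<in> C ` V - {C a}" using ne e(3) by simp
      ultimately have "\<phi> (C a) \<in> \<phi> ` (C ` V - {C a})" by simp
      moreover have "C ` V = insert (C a) (C ` V - {C a})" using e(2) by blast
      ultimately show ?thesis by (metis image_insert insert_absorb)
    qed
    \<comment> \<open>With \<open>C a\<close> dropped, a collision would need the union of
      \<open>C a\<close> and \<open>C b\<close> to be an old component, which is impossible as these
      two are different classes.\<close>
    moreover have "inj_on \<phi> (C ` V - {C a})"
    proof -
      have "C a \<union> C b \<noteq> C x" for x
      proof
        assume *: "C a \<union> C b = C x"
        have "a \<in> C a" "b \<in> C b" using C_mem by simp_all
        then have "a \<in> C x" "b \<in> C x" unfolding *[symmetric] by simp_all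
        then show False using C_mem[of a x] C_mem[of b x] ne by simp
      qed
      then show ?thesis unfolding \<phi>_def by (intro inj_onI) (auto split: if_splits)
    qed
    ultimately have "card (\<phi> ` C ` V) = card (C ` V - {C a})" by (simp add: card_image)
    also have "\<dots> = card (C ` V) - 1" using V e(2) by (simp add: card_Diff_singleton)
    finally show ?thesis using False by (simp add: comp comp' R_def)
  qed
qed

lemma card_components_pos: "finite V \<Longrightarrow> V \<noteq> {} \<Longrightarrow> card (components V F ends) \<ge> 1"
  by (simp add: components_def Suc_le_eq card_gt_0_iff)

text \<open>Without edges every vertex is its own component, and each edge lowers the number of
  components by at most one.\<close>

lemma card_vertices_le:
  assumes V: "finite V" and F: "finite F" and ends: "\<And>e. e \<in> F \<Longrightarrow> \<exists>a\<in>V. \<exists>b\<in>V. ends e = {a, b}"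
  shows "card V \<le> card (components V F ends) + card F"
  using F ends
proof (induction F)
  case empty
  have "(adjacency {} ends)\<^sup>* = Id" by (simp add: adjacency_def)
  then have "components V {} ends = (\<lambda>v. {v}) ` V" by (simp add: components_def)
  then show ?case by (simp add: card_image)
next
  case (insert e F)
  then obtain a b where "a \<in> V" "b \<in> V" "ends e = {a, b}" by blast
  with insert card_components_insert[OF V, of ends e a b F] show ?case
    by (auto split: if_splits)
qed

text \<open>Now every inserted edge is a bridge, so each one lowers the number of components by
  exactly one.\<close>

lemma card_vertices_acyclic:
  assumes V: "finite V" and F: "finite F" and ends: "\<And>e. e \<in> F \<Longrightarrow> \<exists>a\<in>V. \<exists>b\<in>V. ends e = {a, b}"
    and ac: "acyclic_graph F ends"
  shows "card V = card (components V F ends) + card F"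
  using F ends ac
proof (induction F)
  case empty
  have "(adjacency {} ends)\<^sup>* = Id" by (simp add: adjacency_def)
  then have "components V {} ends = (\<lambda>v. {v}) ` V" by (simp add: components_def)
  then show ?case by (simp add: card_image)
next
  case (insert e F)
  then obtain a b where ab: "a \<in> V" "b \<in> V" "ends e = {a, b}" by blast
  have "acyclic_graph F ends"
    using insert.prems(2) by (auto simp: acyclic_graph_def is_cycle_def)
  moreover have "insert e F - {e} = F" using insert.hyps by simp
  then have "(a, b) \<notin> (adjacency F ends)\<^sup>*"
    using insert.prems(2) ab(3) unfolding acyclic_graph_iff_bridges by (metis insertI1)
  \<comment> \<open>Makes the truncated subtraction in \<open>card_components_insert\<close> a
    genuine one.\<close>
  moreover have "card (components V F ends) \<ge> 1"
    using ab V by (intro card_components_pos) auto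
  ultimately show ?case using insert ab card_components_insert[OF V, of ends e a b F]
    by auto
qed

lemma connected_graph_components:
  assumes "connected_graph V F ends"
  shows "card (components V F ends) = 1"
proof -
  from assms obtain r where r: "r \<in> V" by (auto simp: connected_graph_def)
  have "(adjacency F ends)\<^sup>* `` {v} = (adjacency F ends)\<^sup>* `` {r}" if "v \<in> V" for v
    using assms r that by (intro equiv_class_eq[OF equiv_reach]) (auto simp: connected_graph_def)
  then have "components V F ends = (\<lambda>_. (adjacency F ends)\<^sup>* `` {r}) ` V"
    unfolding components_def by (rule image_cong[OF refl])
  then show ?thesis using r by (simp add: image_constant_conv split: if_splits)
qed

text \<open>An edge that is not a bridge can be replaced by a detour in every walk.\<close>

lemma connected_graph_remove:
  assumes "connected_graph V F ends" "e \<in> F" "ends e = {u, v}"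
    "(u, v) \<in> (adjacency (F - {e}) ends)\<^sup>*"
  shows "connected_graph V (F - {e}) ends"
proof -
  have "adjacency F ends \<subseteq> (adjacency (F - {e}) ends)\<^sup>*"
  proof
    fix x assume "x \<in> adjacency F ends"
    then obtain e' a b where x: "x = (a, b)" "e' \<in> F" "ends e' = {a, b}"
      by (auto simp: adjacency_def)
    show "x \<in> (adjacency (F - {e}) ends)\<^sup>*"
    proof (cases "e' = e")
      case True
      then show ?thesis using x assms(3,4) reach_sym[OF assms(4)] by (auto simp: doubleton_eq_iff)
    next
      case False
      then show ?thesis using x by (auto simp: adjacency_def)
    qed
  qed
  then have "(adjacency F ends)\<^sup>* \<subseteq> (adjacency (F - {e}) ends)\<^sup>*"
    by (rule rtrancl_subset_rtrancl)
  then show ?thesis using assms(1) by (auto simp: connected_graph_def)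
qed

text \<open>Cauchy-Binet selects edge sets by cardinality, so trees have to be recognised that way.
  For the converse, removing a non-bridge would leave a connected graph with too few edges.\<close>

lemma tree_graph_iff_card:
  assumes V: "finite V" and F: "finite F" and ends: "\<And>e. e \<in> F \<Longrightarrow> \<exists>a\<in>V. \<exists>b\<in>V. ends e = {a, b}"
  shows "tree_graph V F ends \<longleftrightarrow> connected_graph V F ends \<and> card V = Suc (card F)"
proof
  assume "tree_graph V F ends"
  then have t: "connected_graph V F ends" "acyclic_graph F ends" by (simp_all add: tree_graph_def)
  have "card V = card (components V F ends) + card F"
    by (rule card_vertices_acyclic[OF V F _ t(2)]) (rule ends)
  then show "connected_graph V F ends \<and> card V = Suc (card F)"
    using connected_graph_components[OF t(1)] t(1) by simp
next
  assume c: "connected_graph V F ends \<and> card V = Suc (card F)"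
  have "acyclic_graph F ends"
    unfolding acyclic_graph_iff_bridges
  proof (intro ballI allI impI notI)
    fix e u v assume e: "e \<in> F" "ends e = {u, v}" "(u, v) \<in> (adjacency (F - {e}) ends)\<^sup>*"
    have "connected_graph V (F - {e}) ends" by (rule connected_graph_remove) (use c e in simp_all)
    then have "card (components V (F - {e}) ends) = 1" by (rule connected_graph_components)
    moreover have "card V \<le> card (components V (F - {e}) ends) + card (F - {e})"
      by (rule card_vertices_le[OF V], use F in simp, use ends in blast)
    ultimately have "card V \<le> 1 + card (F - {e})" by simp
    moreover have "card (F - {e}) < card F" using F e(1) by (rule card_Diff1_less)
    ultimately show False using c by linarith
  qed
  then show "tree_graph V F ends" using c by (simp add: tree_graph_def)
qed

text \<open>Non-bridges are deleted until none is left. Applied to the quotient, this makes the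
  denominator of the theorem nonzero.\<close>

lemma spanning_tree_exists:
  assumes "connected_graph V F ends" "finite F"
  shows "\<exists>T\<subseteq>F. tree_graph V T ends"
  using assms(2,1)
proof (induction F rule: finite_psubset_induct)
  case (psubset F)
  show ?case
  proof (cases "acyclic_graph F ends")
    case True
    then show ?thesis using psubset.prems by (auto simp: tree_graph_def)
  next
    case False
    then obtain e u v where "e \<in> F" "ends e = {u, v}" "(u, v) \<in> (adjacency (F - {e}) ends)\<^sup>*"
      unfolding acyclic_graph_iff_bridges by blast
    then have "connected_graph V (F - {e}) ends" "F - {e} \<subset> F"
      using connected_graph_remove[OF psubset.prems] by blast+
    then obtain T where "T \<subseteq> F - {e}" "tree_graph V T ends" using psubset.IH by metis
    then show ?thesis by blast
  qed
qed

section \<open>The matrix-tree theorem\<close>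

text \<open>An orientation is carried by \<open>src\<close> and \<open>tgt\<close>; its choice only
  affects signs. A loop gets the zero vector. The values are integers so that invertibility can be
  argued over \<open>int\<close>, where a unit is 1 or -1.\<close>

definition incidence :: "('e \<Rightarrow> 'v) \<Rightarrow> ('e \<Rightarrow> 'v) \<Rightarrow> 'e \<Rightarrow> 'v \<Rightarrow> int" where
  "incidence src tgt e v = of_bool (src e = v) - of_bool (tgt e = v)"

lemma sum_incidence_mult:
  fixes q :: "'v \<Rightarrow> 'a :: comm_ring_1"
  assumes "finite V" "src e \<in> V" "tgt e \<in> V"
  shows "(\<Sum>v\<in>V. of_int (incidence src tgt e v) * q v) = q (src e) - q (tgt e)"
proof -
  have "(\<Sum>v\<in>V. of_int (incidence src tgt e v) * q v) =
      (\<Sum>v\<in>V. (if src e = v then q v else 0) - (if tgt e = v then q v else 0))"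
    by (intro sum.cong refl) (auto simp: incidence_def)
  also have "\<dots> = q (src e) - q (tgt e)"
    using assms by (simp add: sum_subtractf)
  finally show ?thesis .
qed

text \<open>The coefficients form a unit flow along a path from \<open>u\<close> to
  \<open>v\<close>; the contributions of intermediate vertices telescope.\<close>

lemma path_combination:
  assumes uv: "(u, v) \<in> (adjacency F ends)\<^sup>*" and F: "finite F"
    and ends: "\<And>e. e \<in> F \<Longrightarrow> ends e = {src e, tgt e}"
  shows "\<exists>x. \<forall>y. (\<Sum>e\<in>F. x e * incidence src tgt e y) = of_bool (u = y) - of_bool (v = y)"
  using uv
proof (induction rule: rtrancl_induct)
  case base
  show ?case by (rule exI[of _ "\<lambda>_. 0"]) simp
next
  case (step v w)
  then obtain x where x: "\<And>y. (\<Sum>e\<in>F. x e * incidence src tgt e y) = of_bool (u = y) - of_bool (v = y)"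
    by blast
  obtain e' where e': "e' \<in> F" "ends e' = {v, w}"
    using step.hyps by (auto simp: adjacency_def)
  \<comment> \<open>\<open>s\<close> is 1 or -1 according to whether the step follows or opposes the
    orientation of \<open>e'\<close>.\<close>
  have "\<exists>s. \<forall>y. s * incidence src tgt e' y = of_bool (v = y) - of_bool (w = y)"
  proof -
    consider "src e' = v" "tgt e' = w" | "src e' = w" "tgt e' = v"
      using ends[OF e'(1)] e'(2) by (auto simp: doubleton_eq_iff)
    then show ?thesis
    proof cases
      case 1
      then show ?thesis by (intro exI[of _ 1]) (simp add: incidence_def)
    next
      case 2
      then show ?thesis by (intro exI[of _ "-1"]) (simp add: incidence_def)
    qed
  qed
  then obtain s where s: "\<And>y. s * incidence src tgt e' y = of_bool (v = y) - of_bool (w = y)"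
    by blast
  have "(\<Sum>e\<in>F. (x e + (if e = e' then s else 0)) * incidence src tgt e y) =
      of_bool (u = y) - of_bool (w = y)" for y
  proof -
    have "(\<Sum>e\<in>F. (x e + (if e = e' then s else 0)) * incidence src tgt e y) =
        (\<Sum>e\<in>F. x e * incidence src tgt e y) +
        (\<Sum>e\<in>F. if e = e' then s * incidence src tgt e y else 0)"
      unfolding sum.distrib[symmetric] by (intro sum.cong) (auto simp: algebra_simps)
    also have "\<dots> = of_bool (u = y) - of_bool (w = y)"
      using e'(1) F by (simp add: x s)
    finally show ?thesis .
  qed
  then show ?case by (intro exI[of _ "\<lambda>e. x e + (if e = e' then s else 0)"]) simp
qed

lemma det_incidence_squared:
  assumes V: "finite V" "r \<in> V" and h: "bij_betw h {0..<N} (V - {r})"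
    and F: "bij_betw en {0..<N} F"
    and ends: "\<And>e. e \<in> F \<Longrightarrow> ends e = {src e, tgt e} \<and> src e \<in> V \<and> tgt e \<in> V"
  shows "(det (mat N N (\<lambda>(i, j). incidence src tgt (en i) (h j))))\<^sup>2 =
    of_bool (connected_graph V F ends)"
proof -
  let ?B = "mat N N (\<lambda>(i, j). incidence src tgt (en i) (h j))"
  define R where "R = (adjacency F ends)\<^sup>*"
  have finF: "finite F" using F bij_betw_finite by blast
  have hV: "h i \<in> V" "h i \<noteq> r" if "i < N" for i
    using h that by (auto simp: bij_betw_def)
  have enF: "en i \<in> F" if "i < N" for i
    using F that by (auto simp: bij_betw_def)
  show ?thesis
  proof (cases "connected_graph V F ends")
    case True
    have "\<forall>i<N. \<exists>x. \<forall>y. (\<Sum>e\<in>F. x e * incidence src tgt e y) = of_bool (h i = y) - of_bool (r = y)"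
    proof (intro allI impI)
      fix i assume "i < N"
      then have "(h i, r) \<in> (adjacency F ends)\<^sup>*"
        using True hV V by (auto simp: connected_graph_def)
      then show "\<exists>x. \<forall>y. (\<Sum>e\<in>F. x e * incidence src tgt e y) = of_bool (h i = y) - of_bool (r = y)"
        by (rule path_combination) (use finF ends in auto)
    qed
    then obtain x where x: "\<And>i y. i < N \<Longrightarrow>
        (\<Sum>e\<in>F. x i e * incidence src tgt e y) = of_bool (h i = y) - of_bool (r = y)"
      by metis
    \<comment> \<open>Row \<open>i\<close> holds the flow from \<open>h i\<close> to
      \<open>r\<close>. Since \<open>r\<close> has no column, these flows form an integral left
      inverse of \<open>?B\<close>, so \<open>det ?B\<close> divides 1.\<close>
    let ?X = "mat N N (\<lambda>(i, j). x i (en j))"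
    have "?X * ?B = 1\<^sub>m N"
    proof (rule eq_matI)
      fix i j assume "i < dim_row (1\<^sub>m N)" "j < dim_col (1\<^sub>m N)"
      then have ij: "i < N" "j < N" by auto
      have "(?X * ?B) $$ (i, j) = (\<Sum>k\<in>{0..<N}. x i (en k) * incidence src tgt (en k) (h j))"
        using ij by (simp add: scalar_prod_def)
      also have "\<dots> = (\<Sum>e\<in>F. x i e * incidence src tgt e (h j))"
        by (rule sum.reindex_bij_betw[OF F])
      also have "\<dots> = of_bool (h i = h j)" using x[OF ij(1)] hV[OF ij(2)] by auto
      also have "\<dots> = 1\<^sub>m N $$ (i, j)"
        using ij h by (auto simp: bij_betw_def inj_on_eq_iff)
      finally show "(?X * ?B) $$ (i, j) = 1\<^sub>m N $$ (i, j)" .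
    qed auto
    moreover have "det (?X * ?B) = det ?X * det ?B" by (rule det_mult[of _ N]) auto
    ultimately have "det ?X * det ?B = 1" by simp
    then have "\<bar>det ?B\<bar> = 1" by (metis dvd_triv_right zdvd1_eq)
    then show ?thesis using True by (simp add: abs_square_eq_1)
  next
    case False
    have "\<exists>v\<in>V. (r, v) \<notin> R"
    proof (rule ccontr)
      assume "\<not> ?thesis"
      then have "(u, v) \<in> R" if "u \<in> V" "v \<in> V" for u v
        using that unfolding R_def by (meson reach_sym rtrancl_trans)
      then show False using False V(2) by (auto simp: connected_graph_def R_def)
    qed
    then obtain v where v: "v \<in> V" "(r, v) \<notin> R" by blast
    then have "v \<in> V - {r}" by (auto simp: R_def)
    then obtain k where k: "k < N" "h k = v"
      unfolding bij_betw_imp_surj_on[OF h, symmetric] by auto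
    \<comment> \<open>The indicator of the vertices cut off from \<open>r\<close>. It is constant
      along edges, hence in the kernel, and nonzero at \<open>v\<close>. It vanishes at
      \<open>r\<close>, so restoring the missing column below changes nothing.\<close>
    define q :: "_ \<Rightarrow> int" where "q v = of_bool ((r, v) \<notin> R)" for v
    let ?z = "vec N (\<lambda>j. q (h j))"
    have "?B *\<^sub>v ?z = 0\<^sub>v N"
    proof (rule eq_vecI)
      fix i assume "i < dim_vec (0\<^sub>v N)"
      then have i: "i < N" by simp
      let ?e = "en i"
      have e: "?e \<in> F" "ends ?e = {src ?e, tgt ?e}" "src ?e \<in> V" "tgt ?e \<in> V"
        using enF[OF i] ends by auto
      then have "(src ?e, tgt ?e) \<in> R" "(tgt ?e, src ?e) \<in> R"
        unfolding R_def by (auto simp: adjacency_def insert_commute)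
      then have "(r, src ?e) \<in> R \<longleftrightarrow> (r, tgt ?e) \<in> R"
        unfolding R_def by (meson rtrancl_trans)
      then have eq: "q (src ?e) = q (tgt ?e)" by (simp add: q_def)
      have "(?B *\<^sub>v ?z) $ i = (\<Sum>j\<in>{0..<N}. incidence src tgt ?e (h j) * q (h j))"
        using i by (simp add: scalar_prod_def)
      also have "\<dots> = (\<Sum>v\<in>V - {r}. incidence src tgt ?e v * q v)"
        by (rule sum.reindex_bij_betw[OF h])
      also have "\<dots> = (\<Sum>v\<in>V. incidence src tgt ?e v * q v)"
        using V by (subst (2) sum.remove[of _ r]) (auto simp: q_def R_def)
      also have "\<dots> = 0"
        using sum_incidence_mult[where src = src and tgt = tgt and q = q, OF V(1) e(3) e(4)] eq by simp
      finally show "(?B *\<^sub>v ?z) $ i = 0\<^sub>v N $ i" using i by simp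
    qed auto
    moreover have "?z \<noteq> 0\<^sub>v N"
    proof
      assume "?z = 0\<^sub>v N"
      then have "?z $ k = 0\<^sub>v N $ k" by simp
      then show False using k v by (simp add: q_def)
    qed
    ultimately have "det ?B = 0"
      by (subst det_0_iff_vec_prod_zero[of _ N]) (auto intro!: exI[of _ ?z])
    then show ?thesis using False by simp
  qed
qed

text \<open>The Laplacian with the row and column of \<open>r\<close> removed is a weighted Gram
  matrix of incidence vectors. By Cauchy-Binet only the connected edge sets with \<open>N\<close>
  edges survive, and on \<open>Suc N\<close> vertices these are the spanning trees.\<close>

theorem matrix_tree_multigraph:
  fixes w :: "'e \<Rightarrow> 'a :: comm_ring_1"
  assumes V: "finite V" "r \<in> V" and h: "bij_betw h {0..<N} (V - {r})" and E: "finite E"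
    and ends: "\<And>e. e \<in> E \<Longrightarrow> ends e = {src e, tgt e} \<and> src e \<in> V \<and> tgt e \<in> V"
  shows "det (mat N N (\<lambda>(i, j). \<Sum>e\<in>E. w e *
      of_int (incidence src tgt e (h i)) * of_int (incidence src tgt e (h j)))) =
    (\<Sum>T | T \<subseteq> E \<and> tree_graph V T ends. \<Prod>e\<in>T. w e)"
proof -
  define en where "en F = (SOME f. bij_betw f {0..<N} F)" for F :: "'e set"
  have en: "bij_betw (en F) {0..<N} F" if "F \<subseteq> E" "card F = N" for F
  proof -
    have "\<exists>f. bij_betw f {0..<N} F"
      using ex_bij_betw_nat_finite[of F] that finite_subset[OF that(1) E] by auto
    then show ?thesis unfolding en_def by (rule someI_ex)
  qed
  have cardV: "card V = Suc N"
    using bij_betw_same_card[OF h] card_Suc_Diff1[OF V] by simp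
  have "det (mat N N (\<lambda>(i, j). \<Sum>e\<in>E. w e *
      of_int (incidence src tgt e (h i)) * of_int (incidence src tgt e (h j)))) =
    (\<Sum>F | F \<subseteq> E \<and> card F = N. (\<Prod>e\<in>F. w e) *
      (det (mat N N (\<lambda>(i, j). of_int (incidence src tgt (en F i) (h j)))))\<^sup>2)"
    by (rule det_gram[OF E en, where b = "\<lambda>e i. of_int (incidence src tgt e (h i))"]) auto
  also have "\<dots> = (\<Sum>F | F \<subseteq> E \<and> card F = N. (\<Prod>e\<in>F. w e) * of_bool (connected_graph V F ends))"
  proof (rule sum.cong[OF refl])
    fix F assume "F \<in> {F. F \<subseteq> E \<and> card F = N}"
    then have F: "F \<subseteq> E" "card F = N" by auto
    let ?B = "mat N N (\<lambda>(i, j). incidence src tgt (en F i) (h j))"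
    \<comment> \<open>The minor is the image of an integer determinant, whose square is already
      known to be 0 or 1.\<close>
    have "mat N N (\<lambda>(i, j). of_int (incidence src tgt (en F i) (h j)) :: 'a) = map_mat of_int ?B"
      by (rule eq_matI) auto
    then have "(det (mat N N (\<lambda>(i, j). of_int (incidence src tgt (en F i) (h j)) :: 'a)))\<^sup>2 =
        of_int ((det ?B)\<^sup>2)"
      by (simp add: of_int_hom.hom_det)
    also have "(det ?B)\<^sup>2 = of_bool (connected_graph V F ends)"
      by (rule det_incidence_squared[OF V h en[OF F]]) (use ends F in blast)
    finally show "(\<Prod>e\<in>F. w e) * (det (mat N N (\<lambda>(i, j). of_int (incidence src tgt (en F i) (h j)))))\<^sup>2 =
        (\<Prod>e\<in>F. w e) * of_bool (connected_graph V F ends)" by simp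
  qed
  also have "\<dots> = (\<Sum>F\<in>{F. F \<subseteq> E \<and> card F = N \<and> connected_graph V F ends}. \<Prod>e\<in>F. w e)"
    by (rule sum.mono_neutral_cong_right) (use E in auto)
  also have "{F. F \<subseteq> E \<and> card F = N \<and> connected_graph V F ends} =
      {T. T \<subseteq> E \<and> tree_graph V T ends}"
  proof -
    have "tree_graph V F ends \<longleftrightarrow> connected_graph V F ends \<and> card V = Suc (card F)"
      if "F \<subseteq> E" for F
      by (rule tree_graph_iff_card[OF V(1)]) (use that E finite_subset ends in blast)+
    then show ?thesis using cardV by auto
  qed
  finally show ?thesis .
qed

section \<open>Schur complements\<close>

text \<open>Block column elimination: the matrix is a block upper triangular matrix with diagonal
  blocks \<open>A - B * W * C\<close> and \<open>D\<close>, times a unitriangular one.\<close>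

lemma det_four_block_schur:
  fixes A :: "'a :: idom mat"
  assumes A: "A \<in> carrier_mat k k" and B: "B \<in> carrier_mat k l"
    and C: "C \<in> carrier_mat l k" and D: "D \<in> carrier_mat l l"
    and W: "W \<in> carrier_mat l l" and inv: "D * W = 1\<^sub>m l"
  shows "det (four_block_mat A B C D) = det (A - B * W * C) * det D"
proof -
  let ?S = "A - B * W * C"
  let ?X = "four_block_mat ?S B (0\<^sub>m l k) D"
  let ?Y = "four_block_mat (1\<^sub>m k) (0\<^sub>m k l) (W * C) (1\<^sub>m l)"
  have S: "?S \<in> carrier_mat k k" using A B C W by auto
  have WC: "W * C \<in> carrier_mat l k" using W C by auto
  have BWC: "B * (W * C) = B * W * C" using B W C by simp
  have "?X * ?Y = four_block_mat (?S * 1\<^sub>m k + B * (W * C)) (?S * 0\<^sub>m k l + B * 1\<^sub>m l)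
      (0\<^sub>m l k * 1\<^sub>m k + D * (W * C)) (0\<^sub>m l k * 0\<^sub>m k l + D * 1\<^sub>m l)"
    by (rule mult_four_block_mat[OF S B _ D _ zero_carrier_mat WC one_carrier_mat]) simp_all
  also have "?S * 1\<^sub>m k + B * (W * C) = A"
  proof -
    have "A - X + X = A" if "X \<in> carrier_mat k k" for X
      using A that by (intro eq_matI) auto
    then show ?thesis unfolding BWC right_mult_one_mat[OF S] using B C W by simp
  qed
  also have "?S * 0\<^sub>m k l + B * 1\<^sub>m l = B"
    unfolding right_mult_zero_mat[OF S] using B by simp
  also have "D * (W * C) = D * W * C" using D W C by simp
  also have "0\<^sub>m l k * 1\<^sub>m k + D * W * C = C" using C unfolding inv by simp
  also have "0\<^sub>m l k * 0\<^sub>m k l + D * 1\<^sub>m l = D" using D by simp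
  finally have "four_block_mat A B C D = ?X * ?Y" ..
  also have "det \<dots> = det ?X * det ?Y"
  proof (rule det_mult)
    show "?X \<in> carrier_mat (k + l) (k + l)" by (rule four_block_carrier_mat[OF S D])
    show "?Y \<in> carrier_mat (k + l) (k + l)" by (rule four_block_carrier_mat) simp_all
  qed
  also have "det ?X = det ?S * det D"
    by (rule det_four_block_mat_lower_left_zero[OF S B refl D])
  also have "det ?Y = det (1\<^sub>m k) * det (1\<^sub>m l)"
    by (rule det_four_block_mat_upper_right_zero[OF _ refl WC]) auto
  finally show ?thesis by simp
qed

text \<open>Here \<open>x\<close> is prescribed and \<open>z\<close> is free. The second block
  equation determines \<open>z\<close>, and substituting it into the first block leaves the Schur
  complement acting on \<open>x\<close>.\<close>

lemma schur_eliminate: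
  fixes A :: "'a :: field mat"
  assumes A: "A \<in> carrier_mat k k" and B: "B \<in> carrier_mat k l"
    and C: "C \<in> carrier_mat l k" and D: "D \<in> carrier_mat l l" and W: "W \<in> carrier_mat l l"
    and inv: "W * D = 1\<^sub>m l" "D * W = 1\<^sub>m l"
    and x: "x \<in> carrier_vec k" and z: "z \<in> carrier_vec l"
  shows "C *\<^sub>v x + D *\<^sub>v z = 0\<^sub>v l \<longleftrightarrow> z = - 1 \<cdot>\<^sub>v (W *\<^sub>v (C *\<^sub>v x))"
    and "C *\<^sub>v x + D *\<^sub>v z = 0\<^sub>v l \<Longrightarrow> A *\<^sub>v x + B *\<^sub>v z = (A - B * W * C) *\<^sub>v x"
proof -
  define u where "u = C *\<^sub>v x"
  have u: "u \<in> carrier_vec l" using C x by (simp add: u_def)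
  have Dz: "D *\<^sub>v z \<in> carrier_vec l" and Wu: "W *\<^sub>v u \<in> carrier_vec l" using D z W u by simp_all
  show iff: "C *\<^sub>v x + D *\<^sub>v z = 0\<^sub>v l \<longleftrightarrow> z = - 1 \<cdot>\<^sub>v (W *\<^sub>v (C *\<^sub>v x))"
    unfolding u_def[symmetric]
  proof
    assume eq: "u + D *\<^sub>v z = 0\<^sub>v l"
    have "D *\<^sub>v z = - 1 \<cdot>\<^sub>v u"
    proof (rule eq_vecI)
      fix i assume "i < dim_vec (- 1 \<cdot>\<^sub>v u)"
      then have i: "i < l" using u by simp
      have "(u + D *\<^sub>v z) $ i = 0" using eq i by simp
      then have "u $ i + (D *\<^sub>v z) $ i = 0" using i Dz by (simp only: index_add_vec carrier_vecD)
      then show "(D *\<^sub>v z) $ i = (- 1 \<cdot>\<^sub>v u) $ i"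
        using i u by (simp add: add_eq_0_iff2 del: index_mult_mat_vec)
    qed (use D u in simp)
    then have "W *\<^sub>v (D *\<^sub>v z) = - 1 \<cdot>\<^sub>v (W *\<^sub>v u)" using mult_mat_vec[OF W u] by simp
    moreover have "W *\<^sub>v (D *\<^sub>v z) = z"
      using assoc_mult_mat_vec[OF W D z] one_mult_mat_vec[OF z] by (simp add: inv)
    ultimately show "z = - 1 \<cdot>\<^sub>v (W *\<^sub>v u)" by simp
  next
    assume "z = - 1 \<cdot>\<^sub>v (W *\<^sub>v u)"
    then have "D *\<^sub>v z = - 1 \<cdot>\<^sub>v (D *\<^sub>v (W *\<^sub>v u))" using mult_mat_vec[OF D Wu] by simp
    also have "D *\<^sub>v (W *\<^sub>v u) = u"
      using assoc_mult_mat_vec[OF D W u] one_mult_mat_vec[OF u] by (simp add: inv)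
    finally have "D *\<^sub>v z = - 1 \<cdot>\<^sub>v u" .
    then show "u + D *\<^sub>v z = 0\<^sub>v l" using u by (intro eq_vecI) auto
  qed
  assume "C *\<^sub>v x + D *\<^sub>v z = 0\<^sub>v l"
  then have z_eq: "z = - 1 \<cdot>\<^sub>v (W *\<^sub>v u)" using iff by (simp add: u_def)
  have BW: "B * W \<in> carrier_mat k l" using B W by simp
  have BWC: "B * W * C \<in> carrier_mat k k" using BW C by simp
  have "B *\<^sub>v z = - 1 \<cdot>\<^sub>v (B *\<^sub>v (W *\<^sub>v u))" unfolding z_eq by (rule mult_mat_vec[OF B Wu])
  also have "B *\<^sub>v (W *\<^sub>v u) = (B * W * C) *\<^sub>v x"
    unfolding u_def using assoc_mult_mat_vec[OF BW C x] assoc_mult_mat_vec[OF B W u[unfolded u_def]] by simp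
  finally have Bz: "B *\<^sub>v z = - 1 \<cdot>\<^sub>v ((B * W * C) *\<^sub>v x)" .
  have "a + - 1 \<cdot>\<^sub>v b = a - b" if "a \<in> carrier_vec k" "b \<in> carrier_vec k" for a b :: "'a vec"
    using that by (intro eq_vecI) auto
  then have "A *\<^sub>v x + B *\<^sub>v z = A *\<^sub>v x - (B * W * C) *\<^sub>v x"
    unfolding Bz using mult_mat_vec_carrier[OF A x] mult_mat_vec_carrier[OF BWC x] .
  then show "A *\<^sub>v x + B *\<^sub>v z = (A - B * W * C) *\<^sub>v x"
    using minus_mult_distrib_mat_vec[OF A BWC x] by simp
qed

lemma invertible_of_det_nonzero:
  fixes D :: "'a :: field mat"
  assumes D: "D \<in> carrier_mat l l" and det: "det D \<noteq> 0"
  obtains W where "W \<in> carrier_mat l l" "W * D = 1\<^sub>m l" "D * W = 1\<^sub>m l"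
  \<comment> \<open>\<open>undefined\<close> merely fills the record extension slot of
    \<open>ring_mat\<close>.\<close>
  using det_non_zero_imp_unit[OF D det, of undefined]
  unfolding Units_def ring_mat_def by auto

section \<open>Superport networks\<close>

context superport_network
begin

text \<open>A canonical representative of each class: \<open>superport_rel\<close> is the kernel of
  this map on \<open>{1..n}\<close>, and quotient vertices can be handled as numbers.\<close>

definition rep :: "nat \<Rightarrow> nat" where
  "rep k = (if k \<in> boundary then root k else k)"

text \<open>Condition (P) is imposed for \<open>i < p\<close> only. Grounding the root of the last
  superport therefore leaves exactly one equation for each remaining root.\<close>

definition ground :: nat where
  "ground = Max (A p)"

abbreviation cls :: "nat \<Rightarrow> nat set" where
  "cls v \<equiv> superport_rel `` {v}"

text \<open>The index set of the eliminated block: the ungrounded roots and the interior vertices.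
  Together with \<open>ground\<close> it is a set of representatives of the quotient.\<close>

definition others :: "nat set" where
  "others = {1..n} - (boundary - roots) - {ground}"

section \<open>Superports, roots and representatives\<close>

lemma finite_superport: "i \<in> {1..p} \<Longrightarrow> finite (A i)"
  using superport_subset finite_subset by blast

lemma finite_edges: "finite E"
proof -
  have "E \<subseteq> Pow {1..n}" using edges by auto
  then show ?thesis by (rule finite_subset) simp
qed

lemma boundary_subset: "boundary \<subseteq> {1..n}"
  unfolding boundary_def using superport_subset by (intro UN_least)

lemma finite_boundary: "finite boundary"
  using boundary_subset finite_subset by blast

text \<open>By \<open>numbering\<close> the superports are consecutive intervals, so their unions
  are initial segments. This identifies the interior with \<open>k > m\<close>, the form used in
  condition (I).\<close>

lemma boundary_eq: "boundary = {1..m}"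
proof -
  have "(\<Union>i\<in>{1..k}. A i) = {1..\<Sum>j=1..k. card (A j)}" if "k \<le> p" for k
    using that
  proof (induction k)
    case (Suc k)
    then have IH: "(\<Union>i\<in>{1..k}. A i) = {1..\<Sum>j=1..k. card (A j)}" by simp
    define a where "a = card (A (Suc k))"
    have "A (Suc k) = {(\<Sum>j=1..k. card (A j)) + 1..(\<Sum>j=1..k. card (A j)) + a}"
      using numbering[of "Suc k"] Suc.prems by (simp add: a_def atLeastLessThanSuc_atLeastAtMost)
    moreover have "(\<Union>i\<in>{1..Suc k}. A i) = (\<Union>i\<in>{1..k}. A i) \<union> A (Suc k)"
      by (simp add: atLeastAtMostSuc_conv Un_commute)
    moreover have "(\<Sum>j=1..Suc k. card (A j)) = (\<Sum>j=1..k. card (A j)) + a" by (simp add: a_def)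
    ultimately show ?case unfolding IH by auto
  qed simp
  then have "boundary = {1..\<Sum>j=1..p. card (A j)}" by (simp add: boundary_def)
  then show ?thesis by (simp add: m_def)
qed

lemma superport_unique: "i \<in> {1..p} \<Longrightarrow> j \<in> {1..p} \<Longrightarrow> k \<in> A i \<Longrightarrow> k \<in> A j \<Longrightarrow> i = j"
  using superport_disjoint unfolding disjoint_family_on_def by blast

lemma superport_boundary: "i \<in> {1..p} \<Longrightarrow> k \<in> A i \<Longrightarrow> k \<in> boundary"
  unfolding boundary_def by blast

lemma superportE:
  assumes "k \<in> boundary"
  obtains i where "i \<in> {1..p}" "k \<in> A i"
  using assms unfolding boundary_def by blast

lemma root_eq: "i \<in> {1..p} \<Longrightarrow> k \<in> A i \<Longrightarrow> root k = Max (A i)"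
  unfolding root_def by (subst the_equality[of _ i]) (use superport_unique in blast)+

lemma Max_superport: "i \<in> {1..p} \<Longrightarrow> Max (A i) \<in> A i"
  by (rule Max_in) (use finite_superport superport_nonempty in blast)+

lemma rep_superport: "i \<in> {1..p} \<Longrightarrow> k \<in> A i \<Longrightarrow> rep k = Max (A i)"
  by (simp add: rep_def superport_boundary root_eq)

lemma rep_interior: "k \<notin> boundary \<Longrightarrow> rep k = k"
  by (simp add: rep_def)

lemma roots_subset: "roots \<subseteq> boundary"
  unfolding roots_def using Max_superport superport_boundary by blast

lemma card_roots: "card roots = p"
proof -
  have "inj_on (\<lambda>i. Max (A i)) {1..p}"
    by (rule inj_onI) (metis Max_superport superport_unique)
  then show ?thesis by (simp add: roots_def card_image)
qed

lemma rep_notin_nonroots: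
  assumes "v \<in> {1..n}"
  shows "rep v \<in> {1..n} - (boundary - roots)"
proof (cases "v \<in> boundary")
  case True
  then obtain i where i: "i \<in> {1..p}" "v \<in> A i" by (rule superportE)
  then have "rep v \<in> roots" by (simp only: rep_superport roots_def) (rule imageI)
  then show ?thesis using roots_subset boundary_subset by blast
qed (use assms in \<open>simp add: rep_interior\<close>)

lemma rep_eq_self_iff:
  assumes "v \<in> {1..n}"
  shows "rep v = v \<longleftrightarrow> v \<notin> boundary - roots"
proof
  assume v: "v \<notin> boundary - roots"
  show "rep v = v"
  proof (cases "v \<in> boundary")
    case True
    then obtain i where "i \<in> {1..p}" "v = Max (A i)" using v by (auto simp: roots_def)
    then show ?thesis using rep_superport Max_superport by metis
  qed (simp add: rep_interior)
qed (use rep_notin_nonroots[OF assms] in auto)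

lemma rep_superport_iff:
  assumes "i \<in> {1..p}" "v \<in> {1..n}"
  shows "rep v = Max (A i) \<longleftrightarrow> v \<in> A i"
proof
  assume v: "rep v = Max (A i)"
  show "v \<in> A i"
  proof (cases "v \<in> boundary")
    case True
    then obtain j where j: "j \<in> {1..p}" "v \<in> A j" by (rule superportE)
    then have "Max (A i) \<in> A j" using v rep_superport[OF j] Max_superport[OF j(1)] by simp
    then have "i = j" using superport_unique[OF assms(1) j(1)] Max_superport[OF assms(1)] by blast
    then show ?thesis using j by simp
  next
    case False
    then show ?thesis using v Max_superport[OF assms(1)] superport_boundary assms(1)
      by (metis rep_interior)
  qed
qed (use assms rep_superport in blast)

lemma ground_in: "ground \<in> roots" "ground \<in> {1..n}"
proof -
  show "ground \<in> roots" using p_ge_1 by (simp add: ground_def roots_def)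
  then show "ground \<in> {1..n}" using roots_subset boundary_subset by blast
qed

lemma rep_ground: "rep ground = ground"
  using rep_eq_self_iff ground_in by simp

section \<open>The quotient multigraph and valid forests\<close>

lemma superport_rel_iff: "(u, v) \<in> superport_rel \<longleftrightarrow> u \<in> {1..n} \<and> v \<in> {1..n} \<and> rep u = rep v"
proof (cases "u \<in> {1..n} \<and> v \<in> {1..n}")
  case True
  have "rep u = rep v \<longleftrightarrow> u = v \<or> (\<exists>i\<in>{1..p}. u \<in> A i \<and> v \<in> A i)"
  proof
    assume r: "rep u = rep v"
    show "u = v \<or> (\<exists>i\<in>{1..p}. u \<in> A i \<and> v \<in> A i)"
    proof (cases "u \<in> boundary \<or> v \<in> boundary")
      case True
      then obtain i where "i \<in> {1..p}" "u \<in> A i \<or> v \<in> A i" using superportE by metis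
      then show ?thesis using r rep_superport_iff \<open>u \<in> {1..n} \<and> v \<in> {1..n}\<close> rep_superport by metis
    next
      case False
      then show ?thesis using r rep_interior by simp
    qed
  qed (use rep_superport in metis)
  then show ?thesis using True by (auto simp: superport_rel_def)
qed (auto simp: superport_rel_def)

lemma equiv_superport_rel: "equiv {1..n} superport_rel"
  by (intro equivI refl_onI symI transI) (auto simp: superport_rel_iff)

lemma cls_eq_iff: "u \<in> {1..n} \<Longrightarrow> v \<in> {1..n} \<Longrightarrow> cls u = cls v \<longleftrightarrow> rep u = rep v"
  using eq_equiv_class_iff[OF equiv_superport_rel] by (simp add: superport_rel_iff)

text \<open>Orients every edge from its smaller to its larger end; all incidence vectors of the
  network and of its quotient use this orientation.\<close>

lemma edge_ends:
  assumes "e \<in> E"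
  shows "e = {Min e, Max e}" "Min e \<in> {1..n}" "Max e \<in> {1..n}"
    "quotient_ends e = {cls (Min e), cls (Max e)}"
proof -
  have e: "e \<subseteq> {1..n}" "card e = 2" using edges[OF assms] by auto
  then obtain x y where "e = {x, y}" "x \<noteq> y" by (auto simp: card_2_iff)
  then show eq: "e = {Min e, Max e}" by (cases "x < y") auto
  then show "Min e \<in> {1..n}" "Max e \<in> {1..n}" using e(1) by blast+
  show "quotient_ends e = {cls (Min e), cls (Max e)}"
    unfolding quotient_ends_def by (subst eq) simp
qed

lemma quotient_path:
  assumes "(u, v) \<in> (adjacency F (\<lambda>e. e))\<^sup>*"
  shows "(cls u, cls v) \<in> (adjacency F quotient_ends)\<^sup>*"
  using assms
proof (induction rule: rtrancl_induct)
  case (step v w)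
  then have "{v, w} \<in> F" by (auto simp: adjacency_def)
  moreover have "quotient_ends {v, w} = {cls v, cls w}" by (simp add: quotient_ends_def)
  ultimately have "(cls v, cls w) \<in> adjacency F quotient_ends"
    unfolding adjacency_def by blast
  with step.IH show ?case by (rule rtrancl_into_rtrancl)
qed simp

text \<open>A detour around an edge of the network projects to a detour around it in the quotient,
  so acyclicity passes from the quotient to the network. The resulting form matches
  \<open>matrix_tree_multigraph\<close>.\<close>

lemma valid_forests_eq:
  "valid_forests = {F. F \<subseteq> E \<and> tree_graph ({1..n} // superport_rel) F quotient_ends}"
proof -
  have "acyclic_graph F (\<lambda>e. e)"
    if "acyclic_graph F quotient_ends" for F
    unfolding acyclic_graph_iff_bridges
  proof (intro ballI allI impI notI)
    fix e u v assume e: "e \<in> F" "e = {u, v}" "(u, v) \<in> (adjacency (F - {e}) (\<lambda>e. e))\<^sup>*"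
    then have "(cls u, cls v) \<in> (adjacency (F - {e}) quotient_ends)\<^sup>*"
      by (intro quotient_path)
    moreover have "quotient_ends e = {cls u, cls v}" using e(2) by (simp add: quotient_ends_def)
    ultimately show False using that e(1) unfolding acyclic_graph_iff_bridges by blast
  qed
  then show ?thesis
    unfolding valid_forests_def spanning_forests_def tree_graph_def by blast
qed

lemma valid_forest_exists: "valid_forests \<noteq> {}"
proof -
  have "connected_graph ({1..n} // superport_rel) E quotient_ends"
    unfolding connected_graph_def
  proof (intro conjI ballI)
    show "{1..n} // superport_rel \<noteq> {}" using ground_in(2) unfolding quotient_def by blast
    fix X Y assume "X \<in> {1..n} // superport_rel" "Y \<in> {1..n} // superport_rel"
    then obtain u v where "u \<in> {1..n}" "v \<in> {1..n}" "X = cls u" "Y = cls v"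
      unfolding quotient_def by blast
    then show "(X, Y) \<in> (adjacency E quotient_ends)\<^sup>*"
      using quotient_path[of u v E] connected by (simp only: connected_graph_def)
  qed
  from spanning_tree_exists[OF this finite_edges] show ?thesis
    unfolding valid_forests_eq by blast
qed

lemma weight_valid_forests_pos: "(\<Sum>F\<in>valid_forests. weight F) > 0"
proof (rule sum_pos)
  show "finite valid_forests"
    unfolding valid_forests_eq using finite_edges by simp
  show "weight F > 0" if "F \<in> valid_forests" for F
    using that conductance_pos unfolding valid_forests_eq weight_def by (intro prod_pos) auto
qed (rule valid_forest_exists)

section \<open>Currents in the adapted coordinates\<close>

lemma sum_current:
  assumes "k \<in> {1..n}"
  shows "(\<Sum>l=1..n. c k l * (U k - U l)) =
    (\<Sum>e\<in>E. g e * of_int (incidence Min Max e k) * (U (Min e) - U (Max e)))"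
proof -
  let ?L = "{l \<in> {1..n}. {k, l} \<in> E}"
  have "(\<Sum>l=1..n. c k l * (U k - U l)) = (\<Sum>l\<in>?L. g {k, l} * (U k - U l))"
    by (rule sum.mono_neutral_cong_right) (auto simp: c_def)
  \<comment> \<open>Reversing an edge flips both the incidence at \<open>k\<close> and the voltage
    difference, so the orientation from \<open>Min\<close> to \<open>Max\<close> costs no
    sign.\<close>
  also have "\<dots> = (\<Sum>l\<in>?L. g {k, l} * of_int (incidence Min Max {k, l} k) *
      (U (Min {k, l}) - U (Max {k, l})))"
  proof (rule sum.cong[OF refl])
    fix l assume "l \<in> ?L"
    then have "k \<noteq> l" using edges[of "{k, l}"] by auto
    then show "g {k, l} * (U k - U l) = g {k, l} * of_int (incidence Min Max {k, l} k) *
      (U (Min {k, l}) - U (Max {k, l}))"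
      by (cases "k < l") (auto simp: incidence_def algebra_simps)
  qed
  also have "\<dots> = (\<Sum>e\<in>{e \<in> E. k \<in> e}. g e * of_int (incidence Min Max e k) * (U (Min e) - U (Max e)))"
  proof (rule sum.reindex_bij_betw)
    show "bij_betw (\<lambda>l. {k, l}) ?L {e \<in> E. k \<in> e}"
    proof (rule bij_betw_imageI)
      show "inj_on (\<lambda>l. {k, l}) ?L" by (auto simp: inj_on_def doubleton_eq_iff)
      show "(\<lambda>l. {k, l}) ` ?L = {e \<in> E. k \<in> e}"
      proof (intro equalityI subsetI)
        fix e assume e: "e \<in> {e \<in> E. k \<in> e}"
        then have "card e = 2" "e \<subseteq> {1..n}" using edges by auto
        then obtain x y where "e = {x, y}" "x \<in> {1..n}" "y \<in> {1..n}" by (auto simp: card_2_iff)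
        then obtain l where "e = {k, l}" "l \<in> {1..n}"
          using e by (cases "k = x") (auto simp: insert_commute)
        then show "e \<in> (\<lambda>l. {k, l}) ` ?L" using e by auto
      qed auto
    qed
  qed
  also have "\<dots> = (\<Sum>e\<in>E. g e * of_int (incidence Min Max e k) * (U (Min e) - U (Max e)))"
  proof (rule sum.mono_neutral_left)
    show "\<forall>e\<in>E - {e \<in> E. k \<in> e}. g e * of_int (incidence Min Max e k) * (U (Min e) - U (Max e)) = 0"
    proof
      fix e assume e: "e \<in> E - {e \<in> E. k \<in> e}"
      then have "Min e \<noteq> k" "Max e \<noteq> k" using edge_ends(1)[of e] by blast+
      then show "g e * of_int (incidence Min Max e k) * (U (Min e) - U (Max e)) = 0"
        by (simp add: incidence_def)
    qed
  qed (use finite_edges in auto)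
  finally show ?thesis .
qed

definition current :: "(nat \<Rightarrow> real) \<Rightarrow> nat \<Rightarrow> real" where
  "current U k = (\<Sum>l=1..n. c k l * (U k - U l))"

text \<open>
  \<open>phi e\<close> is the incidence vector of the edge \<open>e\<close> in the coordinates dual to \<open>coord\<close>; at a root it sums
  the incidence over the whole superport.
\<close>

definition phi :: "nat set \<Rightarrow> nat \<Rightarrow> real" where
  "phi e k = (if k \<in> boundary - roots then of_int (incidence Min Max e k)
    else of_int (incidence (rep \<circ> Min) (rep \<circ> Max) e k))"

text \<open>Voltages of non-roots are measured against their own root, as in (B), and all others
  against the ground, so the free additive constant disappears.\<close>

definition coord :: "(nat \<Rightarrow> real) \<Rightarrow> nat \<Rightarrow> real" where
  "coord U k = (if k \<in> boundary - roots then U k - U (rep k) else U k - U ground)"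

text \<open>Off the non-roots this is the total current leaving a class of the quotient: the
  quantity set to zero by (I) for an interior vertex and by (P) for a root.\<close>

definition flow :: "(nat \<Rightarrow> real) \<Rightarrow> nat \<Rightarrow> real" where
  "flow U k = (if k \<in> boundary - roots then current U k
    else \<Sum>v\<in>{v \<in> {1..n}. rep v = k}. current U v)"

definition gram :: "nat \<Rightarrow> nat \<Rightarrow> real" where
  "gram k l = (\<Sum>e\<in>E. g e * phi e k * phi e l)"

lemma edge_difference:
  assumes "e \<in> E"
  shows "(\<Sum>v=1..n. phi e v * coord U v) = U (Min e) - U (Max e)"
proof -
  let ?NR = "boundary - roots"
  \<comment> \<open>The potential relative to the ground is split as
    \<open>f1 v + f2 (rep v)\<close>: a part inside the superport and a part depending on the class
    only. Each is paired with the matching half of \<open>phi\<close>.\<close>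
  define f1 where "f1 v = (if v \<in> ?NR then U v - U (rep v) else 0)" for v
  define f2 where "f2 v = (if v \<in> ?NR then 0 else U v - U ground)" for v
  note e = edge_ends(2,3)[OF assms]
  have f: "f1 v + f2 (rep v) = U v - U ground" if "v \<in> {1..n}" for v
  proof -
    have "f2 (rep v) = U (rep v) - U ground"
      using rep_notin_nonroots[OF that] by (auto simp: f2_def)
    then show ?thesis using rep_eq_self_iff[OF that] by (cases "v \<in> ?NR") (simp_all add: f1_def)
  qed
  have "(\<Sum>v=1..n. phi e v * coord U v) =
      (\<Sum>v=1..n. of_int (incidence Min Max e v) * f1 v) +
      (\<Sum>v=1..n. of_int (incidence (rep \<circ> Min) (rep \<circ> Max) e v) * f2 v)"
    unfolding sum.distrib[symmetric]
    by (intro sum.cong refl) (auto simp: phi_def coord_def f1_def f2_def)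
  also have "(\<Sum>v=1..n. of_int (incidence Min Max e v) * f1 v) = f1 (Min e) - f1 (Max e)"
    by (rule sum_incidence_mult) (use e in auto)
  also have "(\<Sum>v=1..n. of_int (incidence (rep \<circ> Min) (rep \<circ> Max) e v) * f2 v) =
      f2 ((rep \<circ> Min) e) - f2 ((rep \<circ> Max) e)"
    by (rule sum_incidence_mult) (use e rep_notin_nonroots in auto)
  also have "f1 (Min e) - f1 (Max e) + (f2 ((rep \<circ> Min) e) - f2 ((rep \<circ> Max) e)) =
      (f1 (Min e) + f2 (rep (Min e))) - (f1 (Max e) + f2 (rep (Max e)))" by simp
  also have "\<dots> = U (Min e) - U (Max e)" unfolding f[OF e(1)] f[OF e(2)] by simp
  finally show ?thesis .
qed

lemma flow_edges:
  assumes "k \<in> {1..n}"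
  shows "flow U k = (\<Sum>e\<in>E. g e * phi e k * (U (Min e) - U (Max e)))"
proof (cases "k \<in> boundary - roots")
  case True
  then show ?thesis using sum_current[OF assms, of U]
    by (simp add: flow_def current_def phi_def)
next
  case False
  \<comment> \<open>Adding the incidences of an edge over a whole class gives its incidence in the
    quotient.\<close>
  have "(\<Sum>v\<in>{v \<in> {1..n}. rep v = k}. of_int (incidence Min Max e v)) = phi e k" if "e \<in> E" for e
  proof -
    have "(\<Sum>v\<in>{v \<in> {1..n}. rep v = k}. of_int (incidence Min Max e v)) =
        (\<Sum>v=1..n. of_int (incidence Min Max e v) * (of_bool (rep v = k) :: real))"
      by (rule sum.mono_neutral_cong_left) auto
    also have "\<dots> = of_bool (rep (Min e) = k) - of_bool (rep (Max e) = k)"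
      by (rule sum_incidence_mult) (use edge_ends[OF that] in auto)
    also have "\<dots> = phi e k" using False by (simp add: phi_def incidence_def)
    finally show ?thesis .
  qed
  note phi = this
  have "flow U k = (\<Sum>v\<in>{v \<in> {1..n}. rep v = k}.
      \<Sum>e\<in>E. g e * of_int (incidence Min Max e v) * (U (Min e) - U (Max e)))"
    using False sum_current[of _ U] by (auto simp: flow_def current_def intro!: sum.cong)
  also have "\<dots> = (\<Sum>e\<in>E. \<Sum>v\<in>{v \<in> {1..n}. rep v = k}.
      g e * of_int (incidence Min Max e v) * (U (Min e) - U (Max e)))"
    by (rule sum.swap)
  also have "\<dots> = (\<Sum>e\<in>E. g e * phi e k * (U (Min e) - U (Max e)))"
    by (intro sum.cong refl) (simp add: phi[symmetric] sum_distrib_left sum_distrib_right)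
  finally show ?thesis .
qed

lemma coord_ground: "coord U ground = 0"
  using ground_in by (simp add: coord_def)

text \<open>\<open>phi\<close> governs both how voltage drops depend on \<open>coord\<close> and how
  edge currents add up to \<open>flow\<close>. Hence the same vectors occur on both sides and the
  matrix is a Gram matrix.\<close>

lemma flow_gram:
  assumes "k \<in> {1..n}"
  shows "flow U k = (\<Sum>v\<in>{1..n} - {ground}. gram k v * coord U v)"
proof -
  have "flow U k = (\<Sum>e\<in>E. g e * phi e k * (\<Sum>v=1..n. phi e v * coord U v))"
    unfolding flow_edges[OF assms] by (intro sum.cong refl) (simp only: edge_difference)
  also have "\<dots> = (\<Sum>v=1..n. gram k v * coord U v)"
    unfolding gram_def sum_distrib_left sum_distrib_right
    by (subst sum.swap) (simp add: mult.assoc)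
  also have "\<dots> = (\<Sum>v\<in>{1..n} - {ground}. gram k v * coord U v)"
    by (rule sum.mono_neutral_right) (auto simp: coord_ground)
  finally show ?thesis .
qed

section \<open>Ordering of the vertices and the determinants of the blocks\<close>

definition other :: "nat \<Rightarrow> nat" where
  "other j = sorted_list_of_set others ! j"

definition order :: "nat \<Rightarrow> nat" where
  "order j = (if j < m - p then nonroot j else other (j - (m - p)))"

lemma bij_nonroot: "bij_betw nonroot {0..<m - p} (boundary - roots)"
proof -
  have "card (boundary - roots) = m - p"
    using card_Diff_subset[OF finite_subset[OF roots_subset finite_boundary] roots_subset]
    by (simp add: m_def card_roots)
  then show ?thesis unfolding nonroot_def
    using finite_boundary by (intro bij_betw_nth) (auto simp: atLeast0LessThan)
qed

lemma finite_others: "finite others"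
  by (simp add: others_def)

lemma bij_other: "bij_betw other {0..<card others} others"
  unfolding other_def by (rule bij_betw_nth) (simp_all add: finite_others atLeast0LessThan)

lemma nonroot_in: "j < m - p \<Longrightarrow> nonroot j \<in> boundary - roots"
  using bij_betwE[OF bij_nonroot] by simp

lemma other_in: "j < card others \<Longrightarrow> other j \<in> others"
  using bij_betwE[OF bij_other] by simp

lemma vertices_split:
  "{1..n} - {ground} = (boundary - roots) \<union> others" "(boundary - roots) \<inter> others = {}"
  unfolding others_def using boundary_subset ground_in by blast+

lemma bij_order: "bij_betw order {0..<m - p + card others} ({1..n} - {ground})"
proof -
  have 1: "bij_betw order {0..<m - p} (boundary - roots)"
    using bij_nonroot by (rule bij_betw_cong[THEN iffD1, rotated]) (simp add: order_def)
  have "bij_betw (\<lambda>j. j - (m - p)) {m - p..<m - p + card others} {0..<card others}"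
    by (rule bij_betw_byWitness[where f' = "\<lambda>j. j + (m - p)"]) auto
  then have "bij_betw (other \<circ> (\<lambda>j. j - (m - p))) {m - p..<m - p + card others} others"
    by (rule bij_betw_trans[OF _ bij_other])
  then have 2: "bij_betw order {m - p..<m - p + card others} others"
    by (rule bij_betw_cong[THEN iffD1, rotated]) (simp add: order_def)
  have "{0..<m - p + card others} = {0..<m - p} \<union> {m - p..<m - p + card others}" by auto
  then show ?thesis
    unfolding vertices_split(1) using bij_betw_combine[OF 1 2 vertices_split(2)] by simp
qed

lemma sum_vertices_split:
  fixes f :: "nat \<Rightarrow> real"
  shows "(\<Sum>v\<in>{1..n} - {ground}. f v) =
    (\<Sum>j\<in>{0..<m - p}. f (nonroot j)) + (\<Sum>j\<in>{0..<card others}. f (other j))"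
proof -
  have "(\<Sum>v\<in>{1..n} - {ground}. f v) = (\<Sum>v\<in>boundary - roots. f v) + (\<Sum>v\<in>others. f v)"
    unfolding vertices_split(1)
    by (rule sum.union_disjoint) (use finite_boundary finite_others vertices_split(2) in auto)
  then show ?thesis
    using sum.reindex_bij_betw[OF bij_nonroot, of f] sum.reindex_bij_betw[OF bij_other, of f] by simp
qed

abbreviation block :: "(nat \<Rightarrow> nat) \<Rightarrow> nat \<Rightarrow> (nat \<Rightarrow> nat) \<Rightarrow> nat \<Rightarrow> real mat" where
  "block h k h' l \<equiv> mat k l (\<lambda>(i, j). gram (h i) (h' j))"

text \<open>On \<open>others\<close>, \<open>phi e\<close> is the incidence vector of
  \<open>e\<close> in the quotient, and \<open>cls\<close> maps \<open>others\<close> bijectively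
  onto the classes other than that of the ground. So this block is the reduced Laplacian of the
  quotient.\<close>

lemma det_block_others: "det (block other (card others) other (card others)) = (\<Sum>F\<in>valid_forests. weight F)"
proof -
  let ?V = "{1..n} // superport_rel"
  have others: "k \<in> {1..n}" "k \<notin> boundary - roots" "rep k = k" if "k \<in> others" for k
    using that rep_eq_self_iff[of k] by (auto simp: others_def)
  have "bij_betw cls others (?V - {cls ground})"
  proof (rule bij_betw_imageI)
    show "inj_on cls others"
      using others by (intro inj_onI) (metis cls_eq_iff)
    show "cls ` others = ?V - {cls ground}"
    proof (intro equalityI subsetI)
      fix X assume "X \<in> cls ` others"
      then obtain k where k: "k \<in> others" "X = cls k" by blast
      then have "cls k \<noteq> cls ground"
        using others[OF k(1)] cls_eq_iff ground_in rep_ground by (auto simp: others_def)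
      then show "X \<in> ?V - {cls ground}" using k others(1)[OF k(1)] by (auto intro: quotientI)
    next
      fix X assume X: "X \<in> ?V - {cls ground}"
      then obtain v where v: "v \<in> {1..n}" "X = cls v" unfolding quotient_def by blast
      have r: "rep v \<in> {1..n} - (boundary - roots)" using rep_notin_nonroots[OF v(1)] .
      then have "rep (rep v) = rep v" using rep_eq_self_iff by blast
      then have "X = cls (rep v)" using v r cls_eq_iff[of v "rep v"] by simp
      moreover from this have "rep v \<in> others" using X r by (auto simp: others_def)
      ultimately show "X \<in> cls ` others" by blast
    qed
  qed
  then have bij: "bij_betw (cls \<circ> other) {0..<card others} (?V - {cls ground})"
    by (rule bij_betw_trans[OF bij_other])
  have phi: "phi e k = of_int (incidence (cls \<circ> Min) (cls \<circ> Max) e (cls k))"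
    if "k \<in> others" "e \<in> E" for e k
  proof -
    have "rep v = k \<longleftrightarrow> cls v = cls k" if "v \<in> {1..n}" for v
      using cls_eq_iff[OF that] others[OF \<open>k \<in> others\<close>] by simp
    then show ?thesis
      using others(2)[OF that(1)] edge_ends(2,3)[OF that(2)] by (simp add: phi_def incidence_def)
  qed
  let ?M = "mat (card others) (card others) (\<lambda>(i, j). \<Sum>e\<in>E. g e *
      of_int (incidence (cls \<circ> Min) (cls \<circ> Max) e ((cls \<circ> other) i)) *
      of_int (incidence (cls \<circ> Min) (cls \<circ> Max) e ((cls \<circ> other) j)))"
  have eq: "block other (card others) other (card others) = ?M"
    by (rule eq_matI) (auto simp: gram_def phi other_in intro!: sum.cong)
  have "det ?M = (\<Sum>F | F \<subseteq> E \<and> tree_graph ?V F quotient_ends. \<Prod>e\<in>F. g e)"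
  proof (rule matrix_tree_multigraph)
    show "finite ?V" by (intro finite_quotient) (auto simp: superport_rel_def)
    show "cls ground \<in> ?V" using ground_in by (intro quotientI)
    show "quotient_ends e = {(cls \<circ> Min) e, (cls \<circ> Max) e} \<and> (cls \<circ> Min) e \<in> ?V \<and> (cls \<circ> Max) e \<in> ?V"
      if "e \<in> E" for e using edge_ends[OF that] by (simp add: quotientI)
  qed (fact bij finite_edges)+
  then show ?thesis unfolding eq valid_forests_eq weight_def .
qed

text \<open>The Gram matrix is \<open>S * L * transpose_mat S\<close>, where \<open>L\<close> is the
  reduced Laplacian of the network and \<open>S\<close> is unitriangular, so the change of
  coordinates preserves the determinant.\<close>

lemma det_block_order:
  fixes N :: nat
  defines "N \<equiv> m - p + card others"
  shows "det (block order N order N) = (\<Sum>T\<in>spanning_trees. weight T)"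
proof -
  define b where "b e v = (of_int (incidence Min Max e v) :: real)" for e :: "nat set" and v
  \<comment> \<open>\<open>S\<close> adds the rows of a class into the row of its representative and
    keeps the rows of non-roots.\<close>
  define S where "S = mat N N (\<lambda>(i, j). if order i \<in> boundary - roots then of_bool (i = j)
    else of_bool (rep (order j) = order i) :: real)"
  define L where "L = mat N N (\<lambda>(i, j). \<Sum>e\<in>E. g e * b e (order i) * b e (order j))"
  have ord: "order i \<in> {1..n}" "order i \<noteq> ground" if "i < N" for i
    using bij_betwE[OF bij_order] that unfolding N_def by auto
  have inj: "order i = order j \<longleftrightarrow> i = j" if "i < N" "j < N" for i j
    using bij_betw_imp_inj_on[OF bij_order] that unfolding N_def by (auto simp: inj_on_eq_iff)
  have S: "S \<in> carrier_mat N N" and L: "L \<in> carrier_mat N N" by (auto simp: S_def L_def)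
  have phi: "(\<Sum>j\<in>{0..<N}. S $$ (i, j) * b e (order j)) = phi e (order i)" if "i < N" "e \<in> E" for i e
  proof (cases "order i \<in> boundary - roots")
    case True
    then have "(\<Sum>j\<in>{0..<N}. S $$ (i, j) * b e (order j)) =
        (\<Sum>j\<in>{0..<N}. if i = j then b e (order j) else 0)"
      using that by (intro sum.cong) (auto simp: S_def)
    then show ?thesis using that True by (simp add: phi_def b_def)
  next
    case False
    have "(\<Sum>j\<in>{0..<N}. S $$ (i, j) * b e (order j)) =
        (\<Sum>j\<in>{0..<N}. b e (order j) * of_bool (rep (order j) = order i))"
      using that False by (intro sum.cong) (auto simp: S_def)
    also have "\<dots> = (\<Sum>v\<in>{1..n} - {ground}. b e v * of_bool (rep v = order i))"
      unfolding N_def by (rule sum.reindex_bij_betw[OF bij_order])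
    \<comment> \<open>The ground may be added to the sum: it represents itself and is not
      \<open>order i\<close>.\<close>
    also have "\<dots> = (\<Sum>v=1..n. b e v * of_bool (rep v = order i))"
      by (rule sum.mono_neutral_left) (use rep_ground ord(2)[OF that(1)] in auto)
    also have "\<dots> = of_bool (rep (Min e) = order i) - of_bool (rep (Max e) = order i)"
      unfolding b_def by (rule sum_incidence_mult) (use edge_ends[OF that(2)] in auto)
    also have "\<dots> = phi e (order i)" using False by (simp add: phi_def incidence_def)
    finally show ?thesis .
  qed
  define M where "M = S * L"
  have M: "M \<in> carrier_mat N N" using S L by (simp add: M_def)
  have "block order N order N = M * transpose_mat S"
  proof (rule eq_matI)
    fix i j assume "i < dim_row (M * transpose_mat S)" "j < dim_col (M * transpose_mat S)"
    then have ij: "i < N" "j < N" using S M by auto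
    have M_entry: "M $$ (i, k) = (\<Sum>e\<in>E. g e * phi e (order i) * b e (order k))" if "k < N" for k
    proof -
      have "M $$ (i, k) = (\<Sum>l\<in>{0..<N}. S $$ (i, l) * (\<Sum>e\<in>E. g e * b e (order l) * b e (order k)))"
        using ij that S L by (auto simp: M_def scalar_prod_def L_def intro!: sum.cong)
      also have "\<dots> = (\<Sum>e\<in>E. \<Sum>l\<in>{0..<N}. S $$ (i, l) * (g e * b e (order l) * b e (order k)))"
        unfolding sum_distrib_left by (rule sum.swap)
      also have "\<dots> = (\<Sum>e\<in>E. g e * phi e (order i) * b e (order k))"
        by (intro sum.cong refl)
          (simp add: phi[OF ij(1), symmetric] sum_distrib_left sum_distrib_right mult_ac)
      finally show ?thesis .
    qed
    have "(M * transpose_mat S) $$ (i, j) = (\<Sum>k\<in>{0..<N}. M $$ (i, k) * S $$ (j, k))"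
      using ij S M by (auto simp: scalar_prod_def intro!: sum.cong)
    also have "\<dots> = (\<Sum>k\<in>{0..<N}. \<Sum>e\<in>E. g e * phi e (order i) * b e (order k) * S $$ (j, k))"
      by (intro sum.cong refl) (simp add: M_entry sum_distrib_right)
    also have "\<dots> = (\<Sum>e\<in>E. \<Sum>k\<in>{0..<N}. g e * phi e (order i) * b e (order k) * S $$ (j, k))"
      by (rule sum.swap)
    also have "\<dots> = (\<Sum>e\<in>E. g e * phi e (order i) * phi e (order j))"
      by (intro sum.cong refl) (simp add: phi[OF ij(2), symmetric] sum_distrib_left mult_ac)
    finally show "block order N order N $$ (i, j) = (M * transpose_mat S) $$ (i, j)"
      using ij by (simp add: gram_def)
  qed (use S M in auto)
  then have "det (block order N order N) = det M * det (transpose_mat S)"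
    using det_mult[OF M transpose_carrier_mat[THEN iffD2, OF S]] by simp
  also have "\<dots> = det S * det L * det S"
    unfolding M_def det_mult[OF S L] det_transpose[OF S] by (rule refl)
  also have "det S = 1"
  proof -
    \<comment> \<open>Non-roots come first in \<open>order\<close>. To the right of the diagonal in
      a row of \<open>others\<close> there are only members of \<open>others\<close>, which
      represent themselves and not \<open>order i\<close>.\<close>
    have "det S = prod_list (diag_mat S)"
    proof (rule det_lower_triangular[OF _ S])
      fix i j assume ij: "i < j" "j < N"
      show "S $$ (i, j) = 0"
      proof (cases "order i \<in> boundary - roots")
        case True
        then show ?thesis using ij by (simp add: S_def)
      next
        case False
        then have "\<not> i < m - p" using nonroot_in[of i] by (auto simp: order_def)
        then have "order j = other (j - (m - p))" "j - (m - p) < card others"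
          using ij by (auto simp: order_def N_def)
        then have "order j \<in> others" using other_in by simp
        then have "rep (order j) = order j" using rep_eq_self_iff by (auto simp: others_def)
        then show ?thesis using False ij inj[of i j] by (auto simp: S_def)
      qed
    qed
    also have "\<dots> = (\<Prod>i\<in>{0..<N}. S $$ (i, i))"
      using S by (simp add: prod_list_diag_prod)
    also have "\<dots> = 1"
      using ord rep_eq_self_iff by (intro prod.neutral) (auto simp: S_def)
    finally show ?thesis .
  qed
  also have "det L = (\<Sum>T | T \<subseteq> E \<and> tree_graph {1..n} T (\<lambda>e. e). \<Prod>e\<in>T. g e)"
    unfolding L_def b_def
  proof (rule matrix_tree_multigraph)
    show "bij_betw order {0..<N} ({1..n} - {ground})" unfolding N_def by (rule bij_order)
    show "e = {Min e, Max e} \<and> Min e \<in> {1..n} \<and> Max e \<in> {1..n}" if "e \<in> E" for e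
      using edge_ends[OF that] by blast
  qed (use ground_in finite_edges in auto)
  finally show ?thesis unfolding spanning_trees_def weight_def by simp
qed

section \<open>The network equations in the adapted coordinates\<close>

lemma fiber_interior:
  assumes "k \<in> {1..n}" "k > m"
  shows "k \<in> others" "{v \<in> {1..n}. rep v = k} = {k}"
proof -
  have k: "k \<notin> boundary" using assms by (simp add: boundary_eq)
  then have "k \<noteq> ground" using ground_in roots_subset by blast
  then show "k \<in> others" using assms k by (simp add: others_def)
  have "v = k" if "v \<in> {1..n}" "rep v = k" for v
  proof (rule ccontr)
    assume "v \<noteq> k"
    then have "v \<in> boundary" using that rep_interior by metis
    then obtain i where "i \<in> {1..p}" "v \<in> A i" by (rule superportE)
    then have "rep v \<in> boundary" using rep_superport Max_superport superport_boundary by metis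
    then show False using k that by simp
  qed
  then show "{v \<in> {1..n}. rep v = k} = {k}"
    using assms rep_interior[OF k] by blast
qed

lemma fiber_root:
  assumes "i \<in> {1..<p}"
  shows "Max (A i) \<in> others" "{v \<in> {1..n}. rep v = Max (A i)} = A i"
proof -
  have i: "i \<in> {1..p}" "p \<in> {1..p}" "i \<noteq> p" using assms by auto
  have "Max (A i) \<noteq> ground"
    unfolding ground_def using Max_superport i superport_unique by metis
  moreover have "Max (A i) \<in> roots" using i unfolding roots_def by blast
  ultimately show "Max (A i) \<in> others"
    using roots_subset boundary_subset unfolding others_def by blast
  show "{v \<in> {1..n}. rep v = Max (A i)} = A i"
    using rep_superport_iff[OF i(1)] superport_subset[OF i(1)] by blast
qed

text \<open>Matches the elements of \<open>others\<close> with the equations: an interior vertex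
  with (I), a root other than the ground with (P).\<close>

lemma others_cases:
  assumes "k \<in> others"
  obtains "k \<in> {1..n}" "k > m" | i where "i \<in> {1..<p}" "k = Max (A i)"
proof (cases "k > m")
  case True
  then show ?thesis using assms that(1) by (simp add: others_def)
next
  case False
  then have "k \<in> roots" using assms by (auto simp: others_def boundary_eq)
  then obtain i where i: "i \<in> {1..p}" "k = Max (A i)" unfolding roots_def by blast
  then have "i \<noteq> p" using assms by (auto simp: others_def ground_def)
  then show ?thesis using i that(2)[of i] by simp
qed

lemma others_nonroots: "k \<in> others \<Longrightarrow> k \<in> {1..n} \<and> k \<notin> boundary - roots"
  by (simp add: others_def)

lemma flow_interior: "k \<in> {1..n} \<Longrightarrow> k > m \<Longrightarrow> flow U k = current U k"
  using fiber_interior others_nonroots unfolding flow_def by simp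

lemma flow_root: "i \<in> {1..<p} \<Longrightarrow> flow U (Max (A i)) = (\<Sum>k\<in>A i. current U k)"
  unfolding flow_def using fiber_root[of i] others_nonroots[of "Max (A i)"] by (simp only: if_False)

lemma net_current_solution:
  assumes "is_solution dU U I" "k \<in> {1..n}"
  shows "net_current I k = current U k"
  unfolding net_current_def current_def
  using assms unfolding is_solution_def by (intro sum.cong) blast+

text \<open>(I) and (P) together say that the flow vanishes on \<open>others\<close>, and (B)
  prescribes the coordinates on the non-roots.\<close>

lemma is_solution_iff:
  "is_solution dU U I \<longleftrightarrow> (\<forall>k\<in>{1..n}. \<forall>l\<in>{1..n}. I k l = c k l * (U k - U l)) \<and>
    (\<forall>k\<in>others. flow U k = 0) \<and> (\<forall>k\<in>boundary - roots. coord U k = dU k)"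
proof (cases "\<forall>k\<in>{1..n}. \<forall>l\<in>{1..n}. I k l = c k l * (U k - U l)")
  case True
  have net: "net_current I k = current U k" if "k \<in> {1..n}" for k
    unfolding net_current_def current_def using True that by (intro sum.cong) blast+
  have "(\<Sum>k\<in>A i. net_current I k) = (\<Sum>k\<in>A i. current U k)" if "i \<in> {1..<p}" for i
    by (rule sum.cong[OF refl], rule net) (use superport_subset[of i] that in auto)
  then have P: "(\<Sum>k\<in>A i. net_current I k) = flow U (Max (A i))" if "i \<in> {1..<p}" for i
    using flow_root[OF that] that by simp
  have I: "(\<Sum>l=1..n. I k l) = flow U k" if "k \<in> {1..n}" "k > m" for k
    using net[OF that(1)] flow_interior[OF that] by (simp add: net_current_def)
  have "(\<forall>k\<in>{1..n}. k > m \<longrightarrow> (\<Sum>l=1..n. I k l) = 0) \<and> (\<forall>i\<in>{1..<p}. (\<Sum>k\<in>A i. net_current I k) = 0)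
      \<longleftrightarrow> (\<forall>k\<in>others. flow U k = 0)"
    using I P fiber_interior(1) fiber_root(1) others_cases by metis
  moreover have "(\<forall>k\<in>boundary - roots. U k - U (root k) = dU k) \<longleftrightarrow>
      (\<forall>k\<in>boundary - roots. coord U k = dU k)"
    by (simp add: coord_def rep_def)
  ultimately show ?thesis unfolding is_solution_def by blast
next
  case False
  then show ?thesis unfolding is_solution_def by blast
qed

section \<open>The response matrix as a Schur complement\<close>

lemma coord_surj:
  assumes "X ground = 0"
  shows "\<exists>U. \<forall>k\<in>{1..n}. coord U k = X k"
proof (intro exI ballI)
  \<comment> \<open>Inverts the coordinate change with the ground at voltage 0. The value at
    \<open>rep v\<close> is \<open>X (rep v)\<close> itself, as representatives are never
    non-roots.\<close>
  define U where "U v = (if v \<in> boundary - roots then X v + X (rep v) else X v)" for v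
  fix k assume k: "k \<in> {1..n}"
  have "U (rep k) = X (rep k)" using rep_notin_nonroots[OF k] by (auto simp: U_def)
  moreover have "U ground = 0" using ground_in assms by (simp add: U_def)
  ultimately show "coord U k = X k" by (auto simp: coord_def U_def)
qed

lemma flow_blocks:
  fixes U h k
  defines "x \<equiv> vec (m - p) (\<lambda>j. coord U (nonroot j))"
    and "z \<equiv> vec (card others) (\<lambda>j. coord U (other j))"
  assumes h: "\<And>i. i < k \<Longrightarrow> h i \<in> {1..n}"
  shows "vec k (\<lambda>i. flow U (h i)) =
    block h k nonroot (m - p) *\<^sub>v x + block h k other (card others) *\<^sub>v z"
proof (rule eq_vecI)
  fix i assume "i < dim_vec (block h k nonroot (m - p) *\<^sub>v x + block h k other (card others) *\<^sub>v z)"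
  then have i: "i < k" by simp
  show "vec k (\<lambda>i. flow U (h i)) $ i =
      (block h k nonroot (m - p) *\<^sub>v x + block h k other (card others) *\<^sub>v z) $ i"
    using i flow_gram[OF h[OF i], of U, unfolded sum_vertices_split]
    by (simp add: scalar_prod_def x_def z_def)
qed simp

text \<open>The flow equations on \<open>others\<close> eliminate the voltages \<open>z\<close>
  there. Existence and uniqueness are both needed, as \<open>response\<close> is a definite
  description.\<close>

lemma response_schur:
  fixes W :: "real mat"
  defines "AA \<equiv> block nonroot (m - p) nonroot (m - p)"
    and "BB \<equiv> block nonroot (m - p) other (card others)"
    and "CC \<equiv> block other (card others) nonroot (m - p)"
    and "DD \<equiv> block other (card others) other (card others)"
  assumes W: "W \<in> carrier_mat (card others) (card others)"
    "W * DD = 1\<^sub>m (card others)" "DD * W = 1\<^sub>m (card others)"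
    and d: "d \<in> carrier_vec (m - p)"
  shows "response d = (AA - BB * W * CC) *\<^sub>v d"
proof -
  let ?x = "\<lambda>U. vec (m - p) (\<lambda>j. coord U (nonroot j))"
  let ?z = "\<lambda>U. vec (card others) (\<lambda>j. coord U (other j))"
  have car: "AA \<in> carrier_mat (m - p) (m - p)" "BB \<in> carrier_mat (m - p) (card others)"
    "CC \<in> carrier_mat (card others) (m - p)" "DD \<in> carrier_mat (card others) (card others)"
    by (simp_all add: AA_def BB_def CC_def DD_def)
  note elim = schur_eliminate[OF car W(1) W(2) W(3)]
  have nonroot_V: "nonroot j \<in> {1..n}" if "j < m - p" for j
    using nonroot_in[OF that] boundary_subset by blast
  have other_V: "other j \<in> {1..n}" if "j < card others" for j
    using other_in[OF that] others_nonroots by blast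
  have flow_other: "(\<forall>k\<in>others. flow U k = 0) \<longleftrightarrow> CC *\<^sub>v ?x U + DD *\<^sub>v ?z U = 0\<^sub>v (card others)" for U
  proof -
    have "(\<forall>k\<in>others. flow U k = 0) \<longleftrightarrow> (\<forall>j<card others. flow U (other j) = 0)"
    proof -
      have "(\<forall>k\<in>other ` {0..<card others}. flow U k = 0) \<longleftrightarrow> (\<forall>j<card others. flow U (other j) = 0)"
        by auto
      then show ?thesis unfolding bij_betw_imp_surj_on[OF bij_other] .
    qed
    also have "\<dots> \<longleftrightarrow> vec (card others) (\<lambda>j. flow U (other j)) = 0\<^sub>v (card others)"
      by (auto simp: vec_eq_iff)
    also have "vec (card others) (\<lambda>j. flow U (other j)) = CC *\<^sub>v ?x U + DD *\<^sub>v ?z U"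
      unfolding CC_def DD_def by (rule flow_blocks[OF other_V])
    finally show ?thesis .
  qed
  \<comment> \<open>This holds for every solution, whatever its additive constant, because
    \<open>coord\<close> sees differences only. It yields the uniqueness half.\<close>
  have sol: "vec (m - p) (\<lambda>j. net_current I (nonroot j)) = (AA - BB * W * CC) *\<^sub>v ?x U"
    "?x U = vec (m - p) (\<lambda>j. dU (nonroot j))"
    if s: "is_solution dU U I" for dU U I
  proof -
    have "vec (m - p) (\<lambda>j. net_current I (nonroot j)) = vec (m - p) (\<lambda>j. flow U (nonroot j))"
      using net_current_solution[OF s nonroot_V] nonroot_in by (intro eq_vecI) (simp_all add: flow_def)
    also have "\<dots> = AA *\<^sub>v ?x U + BB *\<^sub>v ?z U"
      unfolding AA_def BB_def by (rule flow_blocks[OF nonroot_V])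
    also have "\<dots> = (AA - BB * W * CC) *\<^sub>v ?x U"
      by (rule elim(2)) (use s flow_other in \<open>simp_all add: is_solution_iff\<close>)
    finally show "vec (m - p) (\<lambda>j. net_current I (nonroot j)) = (AA - BB * W * CC) *\<^sub>v ?x U" .
    show "?x U = vec (m - p) (\<lambda>j. dU (nonroot j))"
      using s nonroot_in by (intro eq_vecI) (simp_all add: is_solution_iff)
  qed
  have ex: "\<exists>U. ?x U = d \<and> (\<forall>k\<in>others. flow U k = 0)"
  proof -
    \<comment> \<open>The only value for the remaining coordinates that \<open>elim(1)\<close>
      permits.\<close>
    define z where "z = - 1 \<cdot>\<^sub>v (W *\<^sub>v (CC *\<^sub>v d))"
    have z: "z \<in> carrier_vec (card others)" using W(1) car(3) d by (simp add: z_def)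
    define X where "X k = (if k \<in> boundary - roots then d $ inv_into {0..<m - p} nonroot k
      else if k \<in> others then z $ inv_into {0..<card others} other k else 0)" for k
    have "X ground = 0" using ground_in by (simp add: X_def others_def)
    then obtain U where U: "\<And>k. k \<in> {1..n} \<Longrightarrow> coord U k = X k" using coord_surj by blast
    have "X (nonroot j) = d $ j" if "j < m - p" for j
      using nonroot_in[OF that] that bij_betw_inv_into_left[OF bij_nonroot, of j] by (simp add: X_def)
    then have xU: "?x U = d" using d U nonroot_V by (intro eq_vecI) simp_all
    have "X (other j) = z $ j" if "j < card others" for j
      using others_nonroots[OF other_in[OF that]] other_in[OF that] that
        bij_betw_inv_into_left[OF bij_other, of j] by (auto simp: X_def)
    then have "?z U = z" using z U other_V by (intro eq_vecI) simp_all
    then have "CC *\<^sub>v ?x U + DD *\<^sub>v ?z U = 0\<^sub>v (card others)"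
      unfolding xU using elim(1)[OF d z] z_def by simp
    then show ?thesis using xU flow_other by blast
  qed
  then obtain U where U: "?x U = d" "\<forall>k\<in>others. flow U k = 0" by blast
  let ?I = "\<lambda>k l. c k l * (U k - U l)"
  \<comment> \<open>The prescribed differences are read off from \<open>U\<close> itself, so (B)
    holds by construction.\<close>
  have U_sol: "is_solution (coord U) U ?I"
    using U(2) by (simp add: is_solution_iff)
  show ?thesis
    unfolding response_def
  proof (rule the_equality)
    show "\<exists>dU U I. is_solution dU U I \<and> d = vec (m - p) (\<lambda>j. dU (nonroot j)) \<and>
        (AA - BB * W * CC) *\<^sub>v d = vec (m - p) (\<lambda>j. net_current I (nonroot j))"
      using U_sol sol(1)[OF U_sol] U(1) by (intro exI[of _ "coord U"] exI[of _ U] exI[of _ ?I]) simp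
    show "y = (AA - BB * W * CC) *\<^sub>v d"
      if "\<exists>dU U I. is_solution dU U I \<and> d = vec (m - p) (\<lambda>j. dU (nonroot j)) \<and>
        y = vec (m - p) (\<lambda>j. net_current I (nonroot j))" for y
      using that sol by metis
  qed
qed

theorem det_response_matrix:
  "det response_matrix = (\<Sum>T\<in>spanning_trees. weight T) / (\<Sum>F\<in>valid_forests. weight F)"
proof -
  define AA where "AA = block nonroot (m - p) nonroot (m - p)"
  define BB where "BB = block nonroot (m - p) other (card others)"
  define CC where "CC = block other (card others) nonroot (m - p)"
  define DD where "DD = block other (card others) other (card others)"
  have car: "AA \<in> carrier_mat (m - p) (m - p)" "BB \<in> carrier_mat (m - p) (card others)"
    "CC \<in> carrier_mat (card others) (m - p)" "DD \<in> carrier_mat (card others) (card others)"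
    by (simp_all add: AA_def BB_def CC_def DD_def)
  have detD: "det DD = (\<Sum>F\<in>valid_forests. weight F)"
    unfolding DD_def by (rule det_block_others)
  then have "det DD \<noteq> 0" using weight_valid_forests_pos by simp
  then obtain W where W: "W \<in> carrier_mat (card others) (card others)"
    "W * DD = 1\<^sub>m (card others)" "DD * W = 1\<^sub>m (card others)"
    by (rule invertible_of_det_nonzero[OF car(4)])
  have S: "AA - BB * W * CC \<in> carrier_mat (m - p) (m - p)" using car W(1) by auto
  have "response_matrix = AA - BB * W * CC"
  proof (rule eq_matI)
    fix i j assume "i < dim_row (AA - BB * W * CC)" "j < dim_col (AA - BB * W * CC)"
    then have ij: "i < m - p" "j < m - p" using S by auto
    have "response_matrix $$ (i, j) = response (unit_vec (m - p) j) $ i"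
      using ij by (simp add: response_matrix_def)
    also have "response (unit_vec (m - p) j) = (AA - BB * W * CC) *\<^sub>v unit_vec (m - p) j"
      using response_schur[OF W[unfolded DD_def]] by (simp add: AA_def BB_def CC_def)
    also have "\<dots> $ i = (AA - BB * W * CC) $$ (i, j)"
    proof -
      have "(M *\<^sub>v unit_vec (m - p) j) $ i = M $$ (i, j)" if "M \<in> carrier_mat (m - p) (m - p)"
        for M :: "real mat"
        using ij that by (simp add: scalar_prod_right_unit)
      then show ?thesis using S .
    qed
    finally show "response_matrix $$ (i, j) = (AA - BB * W * CC) $$ (i, j)" .
  qed (use S in \<open>auto simp: response_matrix_def\<close>)
  moreover have "det (AA - BB * W * CC) * det DD = (\<Sum>T\<in>spanning_trees. weight T)"
  proof -
    let ?N = "m - p + card others"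
    \<comment> \<open>\<open>order\<close> lists the non-roots before \<open>others\<close>, so the
      Gram matrix splits exactly into the four blocks.\<close>
    have "block order ?N order ?N = four_block_mat AA BB CC DD"
      by (rule eq_matI) (auto simp: AA_def BB_def CC_def DD_def order_def)
    then show ?thesis
      using det_four_block_schur[OF car W(1,3)] det_block_order by simp
  qed
  ultimately show ?thesis
    using detD \<open>det DD \<noteq> 0\<close> by (simp add: nonzero_eq_divide_eq)
qed

end

theorem theorem7p1:
  fixes n p :: nat and E :: "nat set set" and g :: "nat set \<Rightarrow> real" and A :: "nat \<Rightarrow> nat set"
  assumes "superport_network n E g p A"
    and "superport_network.m p A > p"
  shows "Determinant.det (superport_network.response_matrix n E g p A) =
    (\<Sum>T\<in>superport_network.spanning_trees n E. superport_network.weight g T) /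
    (\<Sum>F\<in>superport_network.valid_forests n E p A. superport_network.weight g F)"
  using superport_network.det_response_matrix[OF assms(1)] .

end
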